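(* Let $\tau\in L^{1}_{loc}(\mathbb{R})$ vanish on $(-\infty,0)$ and have convergent (improper) Laplace transform $\mathcal{L}\{\tau;s\}=\int_0^\infty\tau(x)e^{-sx}\,\mathrm{d}x$ for $\Re e\, s>0$. Suppose that one of the following two conditions holds: (T.1) $\tau$ is boundedly decreasing; (T.2) there are $x_0\geq0$ and $\beta\in\mathbb{R}$ such that $e^{\beta x}\tau(x)$ is non-negative and non-decreasing on $[x_0,\infty)$. If $\mathcal{L}\{\tau;s\}$ has pseudomeasure boundary behavior at $s=0$, then $\tau(x)=O(1)$ as $x\to\infty$.
   Context: A real-valued function $\tau$ is boundedly decreasing if there is $\delta>0$ with $\liminf_{x\to\infty}\inf_{h\in[0,\delta]}(\tau(x+h)-\tau(x))>-\infty$; a complex-valued function is boundedly decreasing if its real and imaginary parts are. The Fourier transform is $\hat\varphi(t)=\int e^{-itx}\varphi(x)\,\mathrm{d}x$, extended to tempered distributions by duality. A tempered distribution $f$ is a pseudomeasure if $\hat f\in L^\infty(\mathbb{R})$. A distribution $f$ is a local pseudomeasure at $t_0$ if $f$ coincides with a pseudomeasure on some open neighborhood of $t_0$. An analytic function $F$ on $\Re e\, s>0$ has pseudomeasure boundary behavior at the point $it_0$ if there is an open interval $U\ni t_0$ such that $F(\sigma+it)$ converges in $\mathcal{D}'(U)$ as $\sigma\to0^+$ to a distribution that is a local pseudomeasure at every point of $U$. *)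

theory Defs
  imports "HOL-Analysis.Analysis"
begin

definition bdd_decreasing_real :: "(real \<Rightarrow> real) \<Rightarrow> bool" where
  "bdd_decreasing_real \<tau> \<longleftrightarrow>
     (\<exists>\<delta>>0. Liminf at_top (\<lambda>x. INF h\<in>{0..\<delta>}. ereal (\<tau> (x + h) - \<tau> x)) > -\<infinity>)"

definition bdd_decreasing :: "(real \<Rightarrow> complex) \<Rightarrow> bool" where
  "bdd_decreasing \<tau> \<longleftrightarrow>
     bdd_decreasing_real (\<lambda>x. Re (\<tau> x)) \<and> bdd_decreasing_real (\<lambda>x. Im (\<tau> x))"

definition laplace_partial :: "(real \<Rightarrow> complex) \<Rightarrow> complex \<Rightarrow> real \<Rightarrow> complex" where
  "laplace_partial \<tau> s T = (LINT x:{0..T}|lborel. \<tau> x * exp (- s * complex_of_real x))"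

definition laplace_converges :: "(real \<Rightarrow> complex) \<Rightarrow> complex \<Rightarrow> bool" where
  "laplace_converges \<tau> s \<longleftrightarrow> (\<exists>L. (laplace_partial \<tau> s \<longlongrightarrow> L) at_top)"

definition laplace :: "(real \<Rightarrow> complex) \<Rightarrow> complex \<Rightarrow> complex" where
  "laplace \<tau> s = Lim at_top (laplace_partial \<tau> s)"

fun nderiv :: "nat \<Rightarrow> (real \<Rightarrow> complex) \<Rightarrow> real \<Rightarrow> complex" where
  "nderiv 0 \<phi> = \<phi>"
| "nderiv (Suc n) \<phi> = (\<lambda>x. vector_derivative (nderiv n \<phi>) (at x))"

definition smooth_fun :: "(real \<Rightarrow> complex) \<Rightarrow> bool" where
  "smooth_fun \<phi> \<longleftrightarrow> (\<forall>n x. nderiv n \<phi> differentiable (at x))"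

definition tsupp :: "(real \<Rightarrow> complex) \<Rightarrow> real set" where
  "tsupp \<phi> = closure {x. \<phi> x \<noteq> 0}"

definition test_fun :: "real set \<Rightarrow> (real \<Rightarrow> complex) \<Rightarrow> bool" where
  "test_fun U \<phi> \<longleftrightarrow> smooth_fun \<phi> \<and> compact (tsupp \<phi>) \<and> tsupp \<phi> \<subseteq> U"

definition schwartz_seminorm :: "nat \<Rightarrow> nat \<Rightarrow> (real \<Rightarrow> complex) \<Rightarrow> real" where
  "schwartz_seminorm m n \<phi> = (SUP x. \<bar>x\<bar> ^ m * norm (nderiv n \<phi> x))"

definition schwartz :: "(real \<Rightarrow> complex) \<Rightarrow> bool" where
  "schwartz \<phi> \<longleftrightarrow> smooth_fun \<phi> \<and>
     (\<forall>m n. bounded (range (\<lambda>x. \<bar>x\<bar> ^ m * norm (nderiv n \<phi> x))))"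

definition distribution_on :: "real set \<Rightarrow> ((real \<Rightarrow> complex) \<Rightarrow> complex) \<Rightarrow> bool" where
  "distribution_on U g \<longleftrightarrow>
     (\<forall>\<phi> \<psi> a b. test_fun U \<phi> \<longrightarrow> test_fun U \<psi> \<longrightarrow>
        g (\<lambda>x. a * \<phi> x + b * \<psi> x) = a * g \<phi> + b * g \<psi>) \<and>
     (\<forall>K. compact K \<and> K \<subseteq> U \<longrightarrow>
        (\<exists>C N. \<forall>\<phi>. test_fun U \<phi> \<and> tsupp \<phi> \<subseteq> K \<longrightarrow>
           norm (g \<phi>) \<le> C * (\<Sum>n\<le>N. SUP x. norm (nderiv n \<phi> x))))"

definition tempered :: "((real \<Rightarrow> complex) \<Rightarrow> complex) \<Rightarrow> bool" where
  "tempered f \<longleftrightarrow>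
     (\<forall>\<phi> \<psi> a b. schwartz \<phi> \<longrightarrow> schwartz \<psi> \<longrightarrow>
        f (\<lambda>x. a * \<phi> x + b * \<psi> x) = a * f \<phi> + b * f \<psi>) \<and>
     (\<exists>C N. \<forall>\<phi>. schwartz \<phi> \<longrightarrow>
        norm (f \<phi>) \<le> C * (\<Sum>m\<le>N. \<Sum>n\<le>N. schwartz_seminorm m n \<phi>))"

definition fourier :: "(real \<Rightarrow> complex) \<Rightarrow> real \<Rightarrow> complex" where
  "fourier \<phi> t = (LINT x|lborel. exp (- \<i> * complex_of_real (t * x)) * \<phi> x)"

definition fourier_distr :: "((real \<Rightarrow> complex) \<Rightarrow> complex) \<Rightarrow> (real \<Rightarrow> complex) \<Rightarrow> complex" where
  "fourier_distr f \<psi> = f (fourier \<psi>)"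

definition pseudomeasure :: "((real \<Rightarrow> complex) \<Rightarrow> complex) \<Rightarrow> bool" where
  "pseudomeasure f \<longleftrightarrow> tempered f \<and>
     (\<exists>h::real \<Rightarrow> complex. h \<in> borel_measurable lborel \<and>
        (\<exists>M. AE x in lborel. norm (h x) \<le> M) \<and>
        (\<forall>\<psi>. schwartz \<psi> \<longrightarrow> fourier_distr f \<psi> = (LINT x|lborel. h x * \<psi> x)))"

definition local_pseudomeasure :: "real set \<Rightarrow> ((real \<Rightarrow> complex) \<Rightarrow> complex) \<Rightarrow> real \<Rightarrow> bool" where
  "local_pseudomeasure U g t0 \<longleftrightarrow>
     (\<exists>V f. open V \<and> t0 \<in> V \<and> V \<subseteq> U \<and> pseudomeasure f \<and>
        (\<forall>\<phi>. test_fun V \<phi> \<longrightarrow> g \<phi> = f \<phi>))"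

definition pm_boundary_behavior :: "(complex \<Rightarrow> complex) \<Rightarrow> real \<Rightarrow> bool" where
  "pm_boundary_behavior F t0 \<longleftrightarrow>
     F holomorphic_on {s. Re s > 0} \<and>
     (\<exists>a b g. a < t0 \<and> t0 < b \<and> distribution_on {a<..<b} g \<and>
        (\<forall>\<phi>. test_fun {a<..<b} \<phi> \<longrightarrow>
           ((\<lambda>\<sigma>. LINT t|lborel. F (Complex \<sigma> t) * \<phi> t) \<longlongrightarrow> g \<phi>) (at_right 0)) \<and>
        (\<forall>t\<in>{a<..<b}. local_pseudomeasure {a<..<b} g t))"

end

theory Submission
  imports Defs "HOL-Probability.Probability"
begin

text \<open>
  Let \<open>\<phi>\<close> be the autoconvolution of a small bump function. Its Fourier transform \<open>k\<close> is a square, hence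
  non-negative, and it decays rapidly. Pairing the boundary value of the Laplace transform with
  \<open>e^{ixt} \<phi>(t)\<close> gives the limit of the averages \<open>\<integral> \<tau>(y) e^{-\<sigma>y} k(y - x) dy\<close> as \<open>\<sigma> \<longlongrightarrow> 0\<close>. By Fourier inversion the
  same pairing is \<open>\<integral> h(y) k(y + x) dy\<close> with \<open>h\<close> bounded, so these limits are bounded uniformly in \<open>x\<close>.
  Either Tauberian condition upgrades conditional convergence of the Laplace integrals to absolute
  convergence, which justifies Fubini.

  If \<open>\<tau>\<close> is non-negative and satisfies \<open>\<tau>(x + h) \<ge> c \<tau>(x)\<close> for small \<open>h\<close>, the average near \<open>x\<close> dominates a
  multiple of \<open>\<tau>(x)\<close>. If \<open>\<tau>\<close> is real and boundedly decreasing, then \<open>\<tau>(y) \<ge> -D(1 + y)\<close>, and the same estimate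
  gives \<open>\<tau>(y) = O(y)\<close>, so that \<open>\<sigma> = 0\<close> may be put in the averages. Averaging around \<open>x + H\<close>, respectively
  \<open>x - H\<close>, bounds \<open>\<plusminus>\<tau>(x)\<close> by a constant plus half the supremum of \<open>|\<tau>(y)| / (1 + \<eta>|y|)\<close>, uniformly in \<open>\<eta>\<close>;
  absorb that supremum and let \<open>\<eta> \<longlongrightarrow> 0\<close>.
\<close>

section \<open>Smooth functions and a bump function\<close>

text \<open>The hypotheses on \<tau> are one-sided, so a non-negative kernel is wanted to turn them
  into inequalities between averages. On the frequency side compact support is forced, because
  boundary values are known only near 0. Squaring the transform of a bump reconciles both demands.
  Modulation by e^{ixt} leaves the support unchanged, so one neighbourhood and one kernel serve
  every x. The obstacle is the order of limits. The averages are controlled only as \<sigma> tends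
  to 0, while the absorption argument works at \<sigma> = 0. Passing there uses an integrable
  majorant, and hence a linear bound for \<tau>, which is why k carries the weight 1 + |u|
  throughout. Absorption in turn needs a finite supremum, and the factor 1 + \<eta>|y| provides one
  without entering the final bound. The half in the absorption comes from recentring so far that the
  tail of k has weighted mass at most a quarter of the total, with two terms estimated
  there.\<close>

text \<open>A coinduction principle: a set of functions closed under differentiation contains every
  \<open>nderiv n f\<close> once it contains \<open>f\<close>. Smoothness then reduces to finding a
  family that is closed under one differentiation.\<close>

lemma smooth_funI:
  assumes "f \<in> S"
    and "\<And>f. f \<in> S \<Longrightarrow> \<exists>f'\<in>S. \<forall>x. (f has_vector_derivative f' x) (at x)"
  shows "smooth_fun f"
proof -
  have "nderiv n f \<in> S" for n
  proof (induction n)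
    case (Suc n)
    then obtain f' where f': "f' \<in> S" "\<And>x. (nderiv n f has_vector_derivative f' x) (at x)"
      using assms(2) by blast
    then have "nderiv (Suc n) f = f'"
      by (auto simp: vector_derivative_at)
    with f' show ?case by simp
  qed (use assms in auto)
  then show ?thesis
    unfolding smooth_fun_def
    by (metis assms(2) differentiableI_vector)
qed

lemma nderiv_Suc_shift: "nderiv (Suc n) f = nderiv n (nderiv 1 f)"
  by (induction n) auto

lemma smooth_has_vector_derivative:
  assumes "smooth_fun f"
  shows "(f has_vector_derivative nderiv 1 f x) (at x)"
  using assms unfolding smooth_fun_def
  by (metis One_nat_def nderiv.simps vector_derivative_works)

lemma smooth_nderiv1: "smooth_fun f \<Longrightarrow> smooth_fun (nderiv 1 f)"
  unfolding smooth_fun_def by (metis nderiv_Suc_shift)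

lemma smooth_continuous: "smooth_fun f \<Longrightarrow> continuous_on A f"
  by (meson continuous_at_imp_continuous_on has_vector_derivative_continuous smooth_has_vector_derivative)

text \<open>By the Leibniz rule the derivative of a product is a sum of two products. Products alone
  do not form an evidently closed family; their finite sums do.\<close>

inductive_set smooth_products :: "(real \<Rightarrow> complex) set" where
  mult: "smooth_fun f \<Longrightarrow> smooth_fun g \<Longrightarrow> (\<lambda>x. f x * g x) \<in> smooth_products"
| add: "f \<in> smooth_products \<Longrightarrow> g \<in> smooth_products \<Longrightarrow> (\<lambda>x. f x + g x) \<in> smooth_products"

lemma smooth_mult:
  assumes "smooth_fun f" "smooth_fun g"
  shows "smooth_fun (\<lambda>x. f x * g x)"
proof (rule smooth_funI[of _ smooth_products])
  show "(\<lambda>x. f x * g x) \<in> smooth_products"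
    using assms by (rule smooth_products.mult)
next
  fix f assume "f \<in> smooth_products"
  then show "\<exists>f'\<in>smooth_products. \<forall>x. (f has_vector_derivative f' x) (at x)"
  proof induction
    case (mult f g)
    show ?case
    proof (rule bexI[of _ "\<lambda>x. f x * nderiv 1 g x + nderiv 1 f x * g x"])
      show "\<forall>x. ((\<lambda>x. f x * g x) has_vector_derivative f x * nderiv 1 g x + nderiv 1 f x * g x) (at x)"
        using mult by (auto intro!: has_vector_derivative_mult smooth_has_vector_derivative
             simp del: nderiv.simps One_nat_def)
      show "(\<lambda>x. f x * nderiv 1 g x + nderiv 1 f x * g x) \<in> smooth_products"
        using mult smooth_nderiv1 by (intro smooth_products.intros) auto
    qed
  next
    case (add f g)
    then obtain f' g' where "f' \<in> smooth_products" "g' \<in> smooth_products"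
      "\<And>x. (f has_vector_derivative f' x) (at x)" "\<And>x. (g has_vector_derivative g' x) (at x)"
      by blast
    then show ?case
      by (intro bexI[of _ "\<lambda>x. f' x + g' x"] allI has_vector_derivative_add smooth_products.add)
  qed
qed

lemma smooth_affine: "smooth_fun (\<lambda>t. a + b * of_real t)"
proof (rule smooth_funI[of _ "{f. \<exists>a b. f = (\<lambda>t. a + b * of_real t)}"])
  fix f :: "real \<Rightarrow> complex"
  assume "f \<in> {f. \<exists>a b. f = (\<lambda>t. a + b * of_real t)}"
  then obtain a b where f: "f = (\<lambda>t. a + b * of_real t)" by auto
  have "(f has_vector_derivative b + 0 * of_real x) (at x)" for x
    unfolding f has_vector_derivative_complex_iff
    by (auto intro!: derivative_eq_intros)
  then show "\<exists>f'\<in>{f. \<exists>a b. f = (\<lambda>t. a + b * of_real t)}. \<forall>x. (f has_vector_derivative f' x) (at x)"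
    by (intro bexI[of _ "\<lambda>x. b + 0 * of_real x"]) blast+
qed auto

lemma has_vector_derivative_exp_of_real:
  "((\<lambda>t. exp (c * complex_of_real t)) has_vector_derivative c * exp (c * of_real t)) (at t)"
proof -
  have "((\<lambda>z. exp (c * z)) has_field_derivative c * exp (c * of_real t)) (at (of_real t))"
    by (auto intro!: derivative_eq_intros)
  from has_vector_derivative_real_field[OF this] show ?thesis .
qed

lemma smooth_exp: "smooth_fun (\<lambda>t. exp (c * of_real t))"
proof (rule smooth_funI[of _ "range (\<lambda>a t. a * exp (c * of_real t))"])
  show "(\<lambda>t. exp (c * of_real t)) \<in> range (\<lambda>a t. a * exp (c * of_real t))"
    by (rule image_eqI[of _ _ 1]) auto
  fix f assume "f \<in> range (\<lambda>a t. a * exp (c * complex_of_real t))"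
  then obtain a where f: "f = (\<lambda>t. a * exp (c * of_real t))" by auto
  have "(f has_vector_derivative a * (c * exp (c * of_real t))) (at t)" for t
    unfolding f by (intro has_vector_derivative_mult_right has_vector_derivative_exp_of_real)
  then show "\<exists>f'\<in>range (\<lambda>a t. a * exp (c * of_real t)). \<forall>x. (f has_vector_derivative f' x) (at x)"
    by (intro bexI[of _ "\<lambda>t. (a * c) * exp (c * of_real t)"] range_eqI[of _ _ "a * c"])
      (auto simp: mult.assoc)
qed

section \<open>The flat function exp(-1/x) and the bump built from it\<close>

text \<open>The polynomial in 1/x is carried along because differentiating exp(-1/x) produces such
  factors; with it the family is closed under derivatives. The classical flat function is the case
  \<open>p = 1\<close>.\<close>

definition flat_exp :: "real poly \<Rightarrow> real \<Rightarrow> real" where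
  "flat_exp p x = (if x > 0 then poly p (inverse x) * exp (- inverse x) else 0)"

lemma poly_exp_neg_tendsto_0: "((\<lambda>x. poly p x * exp (- x)) \<longlongrightarrow> 0) (at_top :: real filter)"
proof -
  have "((\<lambda>x. x ^ n * exp (- x)) \<longlongrightarrow> 0) (at_top :: real filter)" for n
    using tendsto_power_div_exp_0[of n] by (simp add: exp_minus field_simps)
  then show ?thesis
    unfolding poly_altdef sum_distrib_right mult.assoc
    by (intro tendsto_null_sum tendsto_mult_right_zero)
qed

text \<open>With y = 1/x, the derivative of p(y) e^{-y} in x is y^2 (p(y) - p'(y)) e^{-y}; the
  factor \<open>[:0, 0, 1:]\<close> is y^2. At the origin the right difference quotient is y p(y)
  e^{-y} with y = 1/h tending to infinity, where the exponential beats the polynomial; the left one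
  is 0.\<close>

lemma flat_exp_has_derivative:
  "(flat_exp p has_real_derivative flat_exp ([:0, 0, 1:] * (p - pderiv p)) x) (at x)"
proof -
  consider "x > 0" | "x < 0" | "x = 0" by linarith
  then show ?thesis
  proof cases
    case 1
    have "((\<lambda>x. poly p (inverse x) * exp (- inverse x)) has_real_derivative
        flat_exp ([:0, 0, 1:] * (p - pderiv p)) x) (at x)"
      using 1 by (auto intro!: derivative_eq_intros simp: flat_exp_def field_simps power2_eq_square)
    moreover have "\<forall>\<^sub>F y in nhds x. flat_exp p y = poly p (inverse y) * exp (- inverse y)"
      using eventually_nhds_in_open[of "{0<..}" x] 1 by (auto elim!: eventually_mono simp: flat_exp_def)
    ultimately show ?thesis
      by (subst DERIV_cong_ev[OF refl _ refl]) auto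
  next
    case 2
    have "\<forall>\<^sub>F y in nhds x. flat_exp p y = 0"
      using eventually_nhds_in_open[of "{..<0}" x] 2 by (auto elim!: eventually_mono simp: flat_exp_def)
    then show ?thesis
      using 2 by (subst DERIV_cong_ev[OF refl _ refl, of _ "\<lambda>_. 0"]) (auto simp: flat_exp_def)
  next
    case 3
    have "((\<lambda>h. poly ([:0, 1:] * p) (inverse h) * exp (- inverse h)) \<longlongrightarrow> 0) (at_right (0::real))"
      using poly_exp_neg_tendsto_0 filterlim_inverse_at_top_right
      by (rule filterlim_compose)
    then have R: "((\<lambda>h. flat_exp p h / h) \<longlongrightarrow> 0) (at_right 0)"
      by (rule tendsto_cong[THEN iffD1, rotated])
        (auto simp: eventually_at_right_less flat_exp_def field_simps
           intro!: eventually_mono[OF eventually_at_right_less[of "0::real"]])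
    have L: "((\<lambda>h. flat_exp p h / h) \<longlongrightarrow> 0) (at_left 0)"
      by (rule tendsto_eventually) (auto simp: flat_exp_def eventually_at_left_field intro!: exI[of _ "-1"])
    have "((\<lambda>h. flat_exp p h / h) \<longlongrightarrow> 0) (at 0)"
      using L R by (rule filterlim_split_at)
    then show ?thesis
      using 3 by (simp add: DERIV_def flat_exp_def)
  qed
qed

lemma smooth_flat_exp: "smooth_fun (\<lambda>t. of_real (flat_exp p (a + b * t)))"
proof (rule smooth_funI[of _ "range (\<lambda>p t. of_real (flat_exp p (a + b * t)))"])
  fix f assume "f \<in> range (\<lambda>p t. complex_of_real (flat_exp p (a + b * t)))"
  then obtain p where f: "f = (\<lambda>t. of_real (flat_exp p (a + b * t)))" by auto
  define q where "q = smult b ([:0, 0, 1:] * (p - pderiv p))"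
  have "((\<lambda>t. flat_exp p (a + b * t)) has_real_derivative flat_exp q (a + b * t)) (at t)" for t
  proof -
    have "((\<lambda>t. a + b * t) has_real_derivative b) (at t)"
      by (auto intro!: derivative_eq_intros)
    from DERIV_chain2[OF flat_exp_has_derivative this] show ?thesis
      by (auto simp: q_def flat_exp_def mult_ac split: if_splits)
  qed
  then have "(f has_vector_derivative of_real (flat_exp q (a + b * t))) (at t)" for t
    unfolding f by (auto simp: has_vector_derivative_complex_iff)
  then show "\<exists>f'\<in>range (\<lambda>p t. of_real (flat_exp p (a + b * t))). \<forall>x. (f has_vector_derivative f' x) (at x)"
    by (intro bexI[of _ "\<lambda>t. of_real (flat_exp q (a + b * t))"]) auto
qed auto

text \<open>The product of exp(-1/(l + t)) and exp(-1/(l - t)), each factor cut off to 0 where its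
  denominator is not positive. The forms \<open>1 * t\<close> and \<open>(-1) * t\<close> are
  spelled out to match a + b t in \<open>smooth_flat_exp\<close>.\<close>

definition bump :: "real \<Rightarrow> real \<Rightarrow> real" where
  "bump l t = flat_exp 1 (l + 1 * t) * flat_exp 1 (l + (-1) * t)"

lemma smooth_bump: "smooth_fun (\<lambda>t. complex_of_real (bump l t))"
  unfolding bump_def of_real_mult by (intro smooth_mult smooth_flat_exp)

lemma bump_nonneg: "0 \<le> bump l t"
  by (auto simp: bump_def flat_exp_def)

lemma bump_eq_0: "\<bar>t\<bar> \<ge> l \<Longrightarrow> bump l t = 0"
  by (auto simp: bump_def flat_exp_def abs_if split: if_splits)

lemma bump_pos: "l > 0 \<Longrightarrow> bump l 0 > 0"
  by (auto simp: bump_def flat_exp_def)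

lemma bump_minus: "bump l (- t) = bump l t"
  by (auto simp: bump_def)

section \<open>Fourier transforms of compactly supported smooth functions\<close>

text \<open>Support is recorded by an explicit radius instead of a closure, so that integrals run
  over a fixed compact interval and the radius can be tracked through convolution.
  \<open>csmooth_imp_test_fun\<close> translates to \<open>test_fun\<close>.\<close>

definition csmooth :: "real \<Rightarrow> (real \<Rightarrow> complex) \<Rightarrow> bool" where
  "csmooth L f \<longleftrightarrow> smooth_fun f \<and> (\<forall>t. \<bar>t\<bar> > L \<longrightarrow> f t = 0)"

lemma compact_support_integral:
  fixes f :: "real \<Rightarrow> complex"
  assumes "continuous_on UNIV f" "\<And>t. \<bar>t\<bar> > L \<Longrightarrow> f t = 0"
  shows "integrable lborel f" "(LINT t|lborel. f t) = integral (cbox (- L) L) f"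
proof -
  have eq: "(\<lambda>t. indicator {- L..L} t *\<^sub>R f t) = f"
  proof
    fix t
    show "indicator {- L..L} t *\<^sub>R f t = f t"
      using assms(2)[of t] by (cases "\<bar>t\<bar> \<le> L") (simp_all add: abs_le_iff minus_le_iff)
  qed
  have *: "set_integrable lborel {- L..L} f"
    by (intro borel_integrable_atLeastAtMost' continuous_on_subset[OF assms(1)]) simp
  then show "integrable lborel f"
    unfolding set_integrable_def eq .
  show "(LINT t|lborel. f t) = integral (cbox (- L) L) f"
    using set_borel_integral_eq_integral(2)[OF *] unfolding set_lebesgue_integral_def eq by simp
qed

lemma csmooth_integrable: "csmooth L f \<Longrightarrow> integrable lborel f"
  by (rule compact_support_integral(1)[of _ L]) (simp_all add: csmooth_def smooth_continuous)

lemma csmooth_mono: "csmooth L f \<Longrightarrow> L \<le> M \<Longrightarrow> csmooth M f"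
  by (auto simp: csmooth_def)

lemma csmooth_mult: "smooth_fun g \<Longrightarrow> csmooth L f \<Longrightarrow> csmooth L (\<lambda>t. g t * f t)"
  by (auto simp: csmooth_def intro: smooth_mult)

lemma csmooth_nderiv1:
  assumes "csmooth L f"
  shows "csmooth L (nderiv 1 f)"
proof -
  have "nderiv 1 f t = 0" if "\<bar>t\<bar> > L" for t
  proof -
    have "open {t. \<bar>t\<bar> > L}"
      by (intro open_Collect_less continuous_intros)
    then have "(f has_vector_derivative 0) (at t)"
      using that assms
      by (intro has_vector_derivative_transform_within_open[OF has_vector_derivative_const])
        (auto simp: csmooth_def)
    then show ?thesis by (simp add: vector_derivative_at)
  qed
  with assms show ?thesis by (auto simp: csmooth_def simp del: nderiv.simps One_nat_def intro: smooth_nderiv1)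
qed

lemma csmooth_imp_test_fun:
  assumes "csmooth L f" "{- L..L} \<subseteq> U"
  shows "test_fun U f"
proof -
  have "{x. f x \<noteq> 0} \<subseteq> {- L..L}"
  proof
    fix x assume "x \<in> {x. f x \<noteq> 0}"
    then have "\<bar>x\<bar> \<le> L"
      using assms(1) unfolding csmooth_def by (metis mem_Collect_eq not_le)
    then show "x \<in> {- L..L}" by auto
  qed
  then have "tsupp f \<subseteq> {- L..L}"
    unfolding tsupp_def by (rule closure_minimal) simp
  moreover have "compact (tsupp f)"
    using calculation bounded_subset[OF bounded_closed_interval[of "-L" L]]
    by (simp add: compact_eq_bounded_closed tsupp_def)
  ultimately show ?thesis
    using assms by (auto simp: test_fun_def csmooth_def)
qed

lemma fourier_csmooth:
  assumes "csmooth L f"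
  shows "fourier f y = integral (cbox (- L) L) (\<lambda>t. exp (- \<i> * of_real (y * t)) * f t)"
  unfolding fourier_def
proof (rule compact_support_integral(2))
  have "continuous_on UNIV f" using assms smooth_continuous by (simp add: csmooth_def)
  then show "continuous_on UNIV (\<lambda>t. exp (- \<i> * of_real (y * t)) * f t)"
    by (intro continuous_intros)
qed (use assms in \<open>simp add: csmooth_def\<close>)

text \<open>Over a fixed compact interval, differentiation under the integral sign follows from
  joint continuity of the differentiated integrand. The result is again the transform of a
  \<open>csmooth\<close> function of the same radius, so such transforms form a family closed under
  differentiation.\<close>

lemma fourier_has_vector_derivative:
  assumes f: "csmooth L f"
  shows "(fourier f has_vector_derivative fourier (\<lambda>t. (- \<i> * of_real t) * f t) y) (at y)"
proof -
  have sm: "smooth_fun f" using f by (simp add: csmooth_def)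
  have g: "csmooth L (\<lambda>t. (- \<i> * of_real t) * f t)"
    using smooth_affine[of 0 "-\<i>"] by (intro csmooth_mult f) simp
  have "((\<lambda>y. integral (cbox (- L) L) (\<lambda>t. exp (- \<i> * of_real (y * t)) * f t)) has_vector_derivative
      integral (cbox (- L) L) (\<lambda>t. exp (- \<i> * of_real (y * t)) * ((- \<i> * of_real t) * f t))) (at y within UNIV)"
  proof (rule leibniz_rule_vector_derivative)
    fix x t :: real
    have "((\<lambda>x. exp ((- \<i> * of_real t) * of_real x) * f t) has_vector_derivative
       ((- \<i> * of_real t) * exp ((- \<i> * of_real t) * of_real x)) * f t) (at x)"
      by (intro has_vector_derivative_mult_left has_vector_derivative_exp_of_real)
    then show "((\<lambda>x. exp (- \<i> * of_real (x * t)) * f t) has_vector_derivative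
       exp (- \<i> * of_real (x * t)) * ((- \<i> * of_real t) * f t)) (at x)"
      by (simp add: mult_ac)
    show "(\<lambda>t. exp (- \<i> * of_real (x * t)) * f t) integrable_on cbox (- L) L"
      by (intro integrable_continuous continuous_intros smooth_continuous sm)
  next
    have "continuous_on (UNIV \<times> cbox (- L) L) (\<lambda>p. f (snd p))"
      by (rule continuous_on_compose2[OF smooth_continuous[OF sm, of UNIV]]) (auto intro: continuous_on_snd continuous_on_id)
    then show "continuous_on (UNIV \<times> cbox (- L) L)
        (\<lambda>(x, t). exp (- \<i> * complex_of_real (x * t)) * (- \<i> * complex_of_real t * f t))"
      unfolding split_beta by (intro continuous_intros)
  qed auto
  then show ?thesis
    unfolding fourier_csmooth[OF f, abs_def] fourier_csmooth[OF g, abs_def] by simp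
qed

lemma smooth_fourier:
  assumes "csmooth L f"
  shows "smooth_fun (fourier f)"
proof (rule smooth_funI[of _ "fourier ` Collect (csmooth L)"])
  fix F assume "F \<in> fourier ` Collect (csmooth L)"
  then obtain f where f: "csmooth L f" "F = fourier f" by auto
  then show "\<exists>f'\<in>fourier ` Collect (csmooth L). \<forall>x. (F has_vector_derivative f' x) (at x)"
    using fourier_has_vector_derivative[OF f(1)] csmooth_mult[OF smooth_affine[of 0 "-\<i>"] f(1)]
    by (intro bexI[of _ "fourier (\<lambda>t. (- \<i> * of_real t) * f t)"]) auto
qed (use assms in auto)

lemma nderiv_fourier:
  assumes "csmooth L f"
  shows "\<exists>g. csmooth L g \<and> nderiv n (fourier f) = fourier g"
proof (induction n)
  case (Suc n)
  then obtain g where g: "csmooth L g" "nderiv n (fourier f) = fourier g" by auto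
  have "nderiv (Suc n) (fourier f) = fourier (\<lambda>t. (- \<i> * of_real t) * g t)"
    unfolding nderiv.simps g(2)
    by (intro ext vector_derivative_at fourier_has_vector_derivative[OF g(1)])
  moreover have "csmooth L (\<lambda>t. (- \<i> * of_real t) * g t)"
    using csmooth_mult[OF smooth_affine[of 0 "-\<i>"] g(1)] by simp
  ultimately show ?case by blast
qed (use assms in auto)

text \<open>Integration by parts: the derivative of e^{-iyt} f(t) integrates to 0 over an interval
  larger than the support.\<close>

lemma fourier_nderiv1:
  assumes "csmooth L f" "L \<ge> 0"
  shows "fourier (nderiv 1 f) y = (\<i> * of_real y) * fourier f y"
proof -
  \<comment> \<open>\<open>csmooth L f\<close> gives zeros only strictly beyond L. Enlarging the
    radius by 1 makes both boundary terms vanish without a continuity argument at the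
    endpoints.\<close>
  define M where "M = L + 1"
  have f: "csmooth M f" using assms csmooth_mono by (auto simp: M_def)
  then have sm: "smooth_fun f" by (simp add: csmooth_def)
  define e where "e = (\<lambda>t. exp ((- \<i> * of_real y) * of_real t))"
  have e: "exp (- \<i> * of_real (y * t)) = e t" for t by (simp add: e_def mult_ac)
  have ce: "continuous_on A e" for A unfolding e_def by (intro continuous_intros)
  have "(e has_vector_derivative (- \<i> * of_real y) * e t) (at t)" for t
    unfolding e_def by (rule has_vector_derivative_exp_of_real)
  then have "((\<lambda>t. e t * f t) has_vector_derivative e t * nderiv 1 f t + ((- \<i> * of_real y) * e t) * f t) (at t within A)" for t A
    by (rule has_vector_derivative_at_within[OF has_vector_derivative_mult[OF _ smooth_has_vector_derivative[OF sm]]])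
  then have "((\<lambda>t. e t * nderiv 1 f t + ((- \<i> * of_real y) * e t) * f t) has_integral
      e M * f M - e (-M) * f (-M)) {-M..M}"
    using assms(2) by (intro fundamental_theorem_of_calculus) (simp_all add: M_def)
  moreover have "f M = 0" "f (-M) = 0" using assms by (simp_all add: csmooth_def M_def)
  ultimately have 1: "((\<lambda>t. e t * nderiv 1 f t + ((- \<i> * of_real y) * e t) * f t) has_integral 0) {-M..M}"
    by (simp only: mult_zero_right diff_zero)
  have "(\<lambda>t. e t * f t) integrable_on {-M..M}"
    by (intro integrable_continuous_real continuous_on_mult ce smooth_continuous sm)
  then have "((\<lambda>t. (- \<i> * of_real y) * (e t * f t)) has_integral
      (- \<i> * of_real y) * integral {-M..M} (\<lambda>t. e t * f t)) {-M..M}"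
    by (intro has_integral_mult_right integrable_integral)
  from has_integral_diff[OF 1 this]
  have "((\<lambda>t. e t * nderiv 1 f t) has_integral 0 - (- \<i> * of_real y) * integral {-M..M} (\<lambda>t. e t * f t)) {-M..M}"
    by (simp only: mult.assoc add_diff_cancel_right')
  then have "integral {-M..M} (\<lambda>t. e t * nderiv 1 f t) = (\<i> * of_real y) * integral {-M..M} (\<lambda>t. e t * f t)"
    by (simp only: integral_unique diff_0 minus_mult_left minus_minus)
  moreover have "fourier (nderiv 1 f) y = integral {-M..M} (\<lambda>t. e t * nderiv 1 f t)"
    unfolding fourier_csmooth[OF csmooth_nderiv1[OF f]] e interval_cbox ..
  moreover have "fourier f y = integral {-M..M} (\<lambda>t. e t * f t)"
    unfolding fourier_csmooth[OF f] e interval_cbox ..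
  ultimately show ?thesis by (simp only: mult.assoc)
qed

lemma fourier_bounded: "norm (fourier f y) \<le> (LINT t|lborel. norm (f t))"
proof -
  have "norm (fourier f y) \<le> (LINT t|lborel. norm (exp (- \<i> * complex_of_real (y * t)) * f t))"
    unfolding fourier_def by (rule integral_norm_bound)
  then show ?thesis by (simp add: norm_mult)
qed

text \<open>After m integrations by parts, |y|^m times the modulus of the transform is the modulus
  of the transform of the m-th derivative, which the L^1 norm of that derivative bounds.\<close>

lemma fourier_decay:
  assumes "csmooth L f" "L \<ge> 0"
  shows "\<exists>C. \<forall>y. \<bar>y\<bar> ^ m * norm (fourier f y) \<le> C"
proof -
  have "csmooth L (nderiv m f) \<and> (\<forall>y. norm (fourier (nderiv m f) y) = \<bar>y\<bar> ^ m * norm (fourier f y))"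
  proof (induction m)
    case (Suc m)
    then have "csmooth L (nderiv 1 (nderiv m f))" using csmooth_nderiv1 by blast
    moreover have "norm (fourier (nderiv 1 (nderiv m f)) y) = \<bar>y\<bar> ^ Suc m * norm (fourier f y)" for y
    proof -
      have "fourier (nderiv 1 (nderiv m f)) y = (\<i> * of_real y) * fourier (nderiv m f) y"
        using Suc assms(2) by (intro fourier_nderiv1) auto
      then have "norm (fourier (nderiv 1 (nderiv m f)) y) = \<bar>y\<bar> * norm (fourier (nderiv m f) y)"
        by (simp only: norm_mult norm_ii norm_of_real mult_1)
      then show ?thesis using Suc by simp
    qed
    ultimately show ?case by simp
  qed (use assms in auto)
  then show ?thesis
    using fourier_bounded[of "nderiv m f"] by (intro exI[of _ "LINT t|lborel. norm (nderiv m f t)"]) metis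
qed

lemma schwartz_fourier:
  assumes "csmooth L f" "L \<ge> 0"
  shows "schwartz (fourier f)"
  unfolding schwartz_def
proof (intro conjI allI)
  show "smooth_fun (fourier f)" using assms smooth_fourier by blast
  fix m n
  obtain g where g: "csmooth L g" "nderiv n (fourier f) = fourier g"
    using nderiv_fourier[OF assms(1)] by blast
  obtain C where "\<And>y. \<bar>y\<bar> ^ m * norm (fourier g y) \<le> C" using fourier_decay[OF g(1) assms(2), of m] by blast
  then show "bounded (range (\<lambda>x. \<bar>x\<bar> ^ m * norm (nderiv n (fourier f) x)))"
    unfolding g(2) by (auto intro!: boundedI[of _ C])
qed

section \<open>Exchange of integrals and autoconvolution\<close>

text \<open>The integrand is dominated by B |a(x)| |b(y)|, a product of integrable functions. This
  shape fits all three exchanges made later: in the transform of the autoconvolution, in Fourier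
  inversion and in the pairing with the Laplace transform.\<close>

lemma Fubini_bounded_kernel:
  fixes a b :: "real \<Rightarrow> complex" and k :: "real \<Rightarrow> real \<Rightarrow> complex"
  assumes a: "integrable lborel a" and b: "integrable lborel b"
    and k: "case_prod k \<in> borel_measurable (lborel \<Otimes>\<^sub>M lborel)" "\<And>x y. norm (k x y) \<le> B"
  shows "(LINT x|lborel. LINT y|lborel. a x * b y * k x y) = (LINT y|lborel. LINT x|lborel. a x * b y * k x y)"
proof -
  note [measurable] = borel_measurable_integrable[OF a] borel_measurable_integrable[OF b] k(1)
  have "integrable (lborel \<Otimes>\<^sub>M lborel) (\<lambda>(x, y). a x * b y)"
  proof (rule lborel_pair.Fubini_integrable)
    show "integrable lborel (\<lambda>x. LINT y|lborel. norm (case (x, y) of (x, y) \<Rightarrow> a x * b y))"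
      using a by (simp add: norm_mult)
    show "AE x in lborel. integrable lborel (\<lambda>y. case (x, y) of (x, y) \<Rightarrow> a x * b y)"
      using b by simp
  qed measurable
  then have "integrable (lborel \<Otimes>\<^sub>M lborel) (\<lambda>p. of_real B * (case p of (x, y) \<Rightarrow> a x * b y))"
    by (rule integrable_mult_right)
  then have "integrable (lborel \<Otimes>\<^sub>M lborel) (\<lambda>(x, y). a x * b y * k x y)"
  proof (rule Bochner_Integration.integrable_bound)
    have "norm (a x * b y * k x y) \<le> norm (of_real B * (a x * b y))" for x y
    proof -
      have "norm (k x y) \<le> \<bar>B\<bar>" using k(2)[of x y] by linarith
      then have "norm (a x) * norm (b y) * norm (k x y) \<le> norm (a x) * norm (b y) * \<bar>B\<bar>"
        by (intro mult_left_mono) auto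
      then show ?thesis by (simp add: norm_mult mult_ac)
    qed
    then show "AE p in lborel \<Otimes>\<^sub>M lborel. norm (case p of (x, y) \<Rightarrow> a x * b y * k x y)
        \<le> norm (of_real B * (case p of (x, y) \<Rightarrow> a x * b y))"
      by (auto simp: split_beta)
  qed measurable
  then show ?thesis by (rule lborel_pair.Fubini_integral[symmetric])
qed

lemma lborel_integral_shift:
  fixes f :: "real \<Rightarrow> 'a :: {banach, second_countable_topology}"
  shows "(LINT x|lborel. f (x - t)) = (LINT x|lborel. f x)"
  using lborel_integral_real_affine[of 1 f "-t"] by simp

lemma lborel_integral_reflect:
  fixes f :: "real \<Rightarrow> 'a :: {banach, second_countable_topology}"
  shows "(LINT x|lborel. f (- x)) = (LINT x|lborel. f x)"
  using lborel_integral_real_affine[of "-1" f 0] by simp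

lemma lborel_integrable_shift:
  fixes f :: "real \<Rightarrow> 'a :: {banach, second_countable_topology}"
  shows "integrable lborel f \<Longrightarrow> integrable lborel (\<lambda>x. f (x - t))"
  using lborel_integrable_real_affine[of f 1 "-t"] by simp

lemma csmooth_measurable: "csmooth L f \<Longrightarrow> f \<in> borel_measurable borel"
  by (simp add: borel_measurable_continuous_onI csmooth_def smooth_continuous)

lemma csmooth_bounded:
  assumes f: "csmooth L f"
  obtains B where "\<And>t. norm (f t) \<le> B"
proof -
  have "continuous_on {-L..L} f" using f by (simp add: csmooth_def smooth_continuous)
  then have "bounded (f ` {-L..L})" using compact_continuous_image compact_imp_bounded by blast
  then obtain B where B: "\<forall>z\<in>f ` {-L..L}. norm z \<le> B" unfolding bounded_iff by blast
  have "norm (f t) \<le> \<bar>B\<bar>" for t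
  proof (cases "\<bar>t\<bar> \<le> L")
    case True
    then have "f t \<in> f ` {-L..L}" by (intro imageI) auto
    then have "norm (f t) \<le> B" using B by blast
    then show ?thesis by linarith
  qed (use f in \<open>auto simp: csmooth_def\<close>)
  then show ?thesis using that by blast
qed

text \<open>The range is cut to [-L, L], where the first factor lives, so that differentiation in t
  under the integral sign takes place over a compact interval.\<close>

definition autoconv :: "real \<Rightarrow> (real \<Rightarrow> complex) \<Rightarrow> real \<Rightarrow> complex" where
  "autoconv L f t = integral (cbox (- L) L) (\<lambda>s. f s * f (t - s))"

text \<open>All derivatives can fall on the second factor: convolutions of the fixed
  \<open>f\<close> with arbitrary smooth g are closed under differentiation. The radius doubles
  because |s| \<le> L and |t| > 2L force |t - s| > L.\<close>

lemma csmooth_autoconv: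
  assumes f: "csmooth L f"
  shows "csmooth (2 * L) (autoconv L f)"
proof -
  let ?C = "\<lambda>g t. integral (cbox (- L) L) (\<lambda>s. f s * g (t - s))"
  have sm: "smooth_fun f" using f by (simp add: csmooth_def)
  have "smooth_fun (?C f)"
  proof (rule smooth_funI[of _ "?C ` Collect smooth_fun"])
    show "?C f \<in> ?C ` Collect smooth_fun" using sm by blast
  next
    fix F assume "F \<in> ?C ` Collect smooth_fun"
    then obtain g where g: "smooth_fun g" "F = ?C g" by blast
    have "(?C g has_vector_derivative ?C (nderiv 1 g) t) (at t within UNIV)" for t
    proof (rule leibniz_rule_vector_derivative)
      fix x s :: real
      have "((\<lambda>x. x - s) has_vector_derivative 1) (at x)"
        by (auto intro!: derivative_eq_intros)
      from vector_diff_chain_at[OF this smooth_has_vector_derivative[OF g(1)]]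
      have "((\<lambda>x. g (x - s)) has_vector_derivative nderiv 1 g (x - s)) (at x)"
        by (simp only: o_def scaleR_one)
      then show "((\<lambda>x. f s * g (x - s)) has_vector_derivative f s * nderiv 1 g (x - s)) (at x)"
        by (rule has_vector_derivative_mult_right)
      show "(\<lambda>s. f s * g (x - s)) integrable_on cbox (- L) L"
        by (intro integrable_continuous continuous_on_mult smooth_continuous[OF sm]
            continuous_on_compose2[OF smooth_continuous[OF g(1), of UNIV]] continuous_intros) auto
    next
      show "continuous_on (UNIV \<times> cbox (- L) L) (\<lambda>(x, s). f s * nderiv 1 g (x - s))"
        unfolding split_beta
        by (intro continuous_on_mult continuous_on_compose2[OF smooth_continuous[OF sm, of UNIV]]
            continuous_on_compose2[OF smooth_continuous[OF smooth_nderiv1[OF g(1)], of UNIV]] continuous_intros) auto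
    qed auto
    then show "\<exists>F'\<in>?C ` Collect smooth_fun. \<forall>t. (F has_vector_derivative F' t) (at t)"
      unfolding g(2) using smooth_nderiv1[OF g(1)]
      by (intro bexI[of _ "?C (nderiv 1 g)"] allI) (simp_all only: mem_Collect_eq image_eqI)
  qed
  moreover have "?C f t = 0" if "\<bar>t\<bar> > 2 * L" for t
  proof -
    have "f (t - s) = 0" if "s \<in> cbox (- L) L" for s
      using f that \<open>\<bar>t\<bar> > 2 * L\<close> by (auto simp: csmooth_def)
    then have "?C f t = integral (cbox (- L) L) (\<lambda>s. 0)"
      by (intro Henstock_Kurzweil_Integration.integral_cong) simp
    then show ?thesis by simp
  qed
  ultimately show ?thesis
    unfolding csmooth_def autoconv_def[abs_def] by blast
qed

lemma autoconv_lborel: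
  assumes "csmooth L f"
  shows "autoconv L f t = (LINT s|lborel. f s * f (t - s))"
  unfolding autoconv_def
proof (rule compact_support_integral(2)[symmetric])
  have sm: "smooth_fun f" using assms by (simp add: csmooth_def)
  show "continuous_on UNIV (\<lambda>s. f s * f (t - s))"
    by (intro continuous_on_mult smooth_continuous[OF sm]
            continuous_on_compose2[OF smooth_continuous[OF sm, of UNIV]] continuous_intros) auto
qed (use assms in \<open>simp add: csmooth_def\<close>)

lemma fourier_autoconv:
  assumes f: "csmooth L f"
  shows "fourier (autoconv L f) u = (fourier f u)\<^sup>2"
proof -
  define e where "e = (\<lambda>t. exp (- \<i> * complex_of_real (u * t)))"
  have e_add: "e (s + t) = e s * e t" for s t
    by (simp add: e_def exp_add[symmetric] algebra_simps)
  have norm_e: "norm (e t) = 1" for t by (simp add: e_def)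
  have [measurable]: "f \<in> borel_measurable borel" "e \<in> borel_measurable borel"
    using csmooth_measurable[OF f] unfolding e_def by measurable
  obtain B where B: "norm (f t) \<le> B" for t
    using csmooth_bounded[OF f] by blast
  \<comment> \<open>Fubini is set up for an integrable function of s, an integrable function of t
    and a bounded kernel. The indicator of [-2L, 2L] plays the second part; inserting it changes
    nothing, since f(s) f(t - s) vanishes for |t| > 2L.\<close>
  define I where "I t = complex_of_real (indicator {- (2 * L)..2 * L} t)" for t
  have intI: "integrable lborel I"
    unfolding I_def by (intro integrable_of_real integrable_real_indicator) (simp_all add: emeasure_lborel_Icc_eq)
  have drop_I: "f s * I t * (e t * f (t - s)) = e t * (f s * f (t - s))" for s t
  proof (cases "\<bar>t\<bar> \<le> 2 * L")
    case True
    then show ?thesis by (simp add: I_def abs_le_iff minus_le_iff)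
  next
    case False
    then have "\<bar>s\<bar> > L \<or> \<bar>t - s\<bar> > L" by linarith
    then show ?thesis using f by (auto simp: csmooth_def)
  qed
  have "fourier (autoconv L f) u = (LINT t|lborel. LINT s|lborel. f s * I t * (e t * f (t - s)))"
    unfolding fourier_def autoconv_lborel[OF f] drop_I by (simp add: e_def)
  also have "\<dots> = (LINT s|lborel. LINT t|lborel. f s * I t * (e t * f (t - s)))"
  proof (rule Fubini_bounded_kernel[OF csmooth_integrable[OF f] intI, symmetric])
    show "norm (e t * f (t - s)) \<le> B" for s t
      using B by (simp add: norm_mult norm_e)
  qed measurable
  also have "\<dots> = (LINT s|lborel. (e s * f s) * fourier f u)"
  proof (intro Bochner_Integration.integral_cong refl)
    fix s
    have "(LINT t|lborel. f s * I t * (e t * f (t - s))) = (LINT t|lborel. (e s * f s) * (e (t - s) * f (t - s)))"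
    proof (intro Bochner_Integration.integral_cong refl)
      fix t
      have E: "e s * e (t - s) = e t" using e_add[of s "t - s"] by simp
      have "(e s * f s) * (e (t - s) * f (t - s)) = (e s * e (t - s)) * (f s * f (t - s))"
        by (simp only: mult_ac)
      then show "f s * I t * (e t * f (t - s)) = (e s * f s) * (e (t - s) * f (t - s))"
        unfolding E drop_I ..
    qed
    also have "\<dots> = (e s * f s) * (LINT t|lborel. e (t - s) * f (t - s))"
      by simp
    also have "(LINT t|lborel. e (t - s) * f (t - s)) = fourier f u"
      using lborel_integral_shift[of "\<lambda>t. e t * f t" s] by (simp add: fourier_def e_def)
    finally show "(LINT t|lborel. f s * I t * (e t * f (t - s))) = (e s * f s) * fourier f u" .
  qed
  also have "\<dots> = (fourier f u)\<^sup>2"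
    unfolding power2_eq_square by (simp add: fourier_def e_def)
  finally show ?thesis .
qed

section \<open>Fourier inversion by Gaussian regularisation\<close>

lemma std_normal_fourier:
  "(LINT v|lborel. std_normal_density v *\<^sub>R exp (\<i> * complex_of_real (t * v))) = of_real (exp (- t\<^sup>2 / 2))"
proof -
  have "(LINT v|lborel. std_normal_density v *\<^sub>R exp (\<i> * complex_of_real (t * v))) = char std_normal_distribution t"
    unfolding char_def by (subst integral_density) auto
  then show ?thesis by (simp add: char_std_normal_distribution)
qed

text \<open>Insert the Gaussian factor \<open>n(\<epsilon>y)\<close>, whose transform is explicit, and let \<open>\<epsilon> \<longlongrightarrow> 0\<close>.\<close>

lemma fourier_inversion:
  assumes f: "csmooth L f" and int: "integrable lborel (fourier f)"
  shows "fourier (fourier f) t = of_real (2 * pi) * f (- t)"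
proof -
  define n where "n = std_normal_density"
  define eps where "eps = (\<lambda>j. inverse (real (Suc j)))"
  have eps_pos: "eps j > 0" for j by (simp add: eps_def)
  have eps_lim: "eps \<longlonglongrightarrow> 0" unfolding eps_def by (rule LIMSEQ_inverse_real_of_nat)
  have n_le: "n v \<le> n 0" and n_nn: "0 \<le> n v" and n_cont: "continuous_on UNIV n" for v
    by (auto simp: n_def std_normal_density_def field_simps intro!: continuous_intros)
  have n_int: "integrable lborel n" unfolding n_def by simp
  have [measurable]: "f \<in> borel_measurable borel" "n \<in> borel_measurable borel"
    "fourier f \<in> borel_measurable borel"
    using csmooth_measurable[OF f] borel_measurable_integrable[OF int] unfolding n_def by auto
  \<comment> \<open>The limit of \<open>J\<close> is found twice. Dominated convergence replaces the
    Gaussian factor by n(0) and leaves n(0) times the double transform. Fubini turns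
    \<open>J j\<close> into sqrt(2 pi) times a Gaussian mean of f about -t at scale
    \<open>eps j\<close>, which tends to sqrt(2 pi) f(-t). Since n(0) = 1/sqrt(2 pi), the constant
    is 2 pi.\<close>
  define J where "J = (\<lambda>j. LINT y|lborel. n (eps j * y) *\<^sub>R (exp (- \<i> * complex_of_real (t * y)) * fourier f y))"
  have lim1: "J \<longlonglongrightarrow> (LINT y|lborel. n 0 *\<^sub>R (exp (- \<i> * complex_of_real (t * y)) * fourier f y))"
    unfolding J_def
  proof (rule integral_dominated_convergence[where w = "\<lambda>y. n 0 * norm (fourier f y)"])
    show "integrable lborel (\<lambda>y. n 0 * norm (fourier f y))" using int by simp
    show "AE y in lborel. (\<lambda>j. n (eps j * y) *\<^sub>R (exp (- \<i> * complex_of_real (t * y)) * fourier f y))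
        \<longlonglongrightarrow> n 0 *\<^sub>R (exp (- \<i> * complex_of_real (t * y)) * fourier f y)"
    proof (intro AE_I2 tendsto_intros)
      fix y
      have "(\<lambda>j. eps j * y) \<longlonglongrightarrow> 0 * y" by (intro tendsto_mult eps_lim tendsto_const)
      then show "(\<lambda>j. n (eps j * y)) \<longlonglongrightarrow> n 0"
        using n_cont by (intro isCont_tendsto_compose[of _ n]) (auto simp: continuous_on_eq_continuous_at)
    qed
    show "AE y in lborel. norm (n (eps j * y) *\<^sub>R (exp (- \<i> * complex_of_real (t * y)) * fourier f y))
        \<le> n 0 * norm (fourier f y)" for j
      by (intro AE_I2) (simp add: norm_mult n_nn n_le mult_right_mono)
  qed measurable
  have J: "J j = of_real (sqrt (2 * pi)) * (LINT v|lborel. n v *\<^sub>R f (eps j * v - t))" for j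
  proof -
    let ?e = "eps j"
    have scaled: "integrable lborel (\<lambda>y. n (?e * y))"
      using lborel_integrable_real_affine[OF n_int, of ?e 0] eps_pos[of j] by simp
    \<comment> \<open>The Gaussian is its own transform up to sqrt(2 pi); rescaling y by
      \<open>?e\<close> divides both the frequency and the value by \<open>?e\<close>.\<close>
    have gauss: "(LINT y|lborel. of_real (n (?e * y)) * exp (- \<i> * complex_of_real (w * y)))
       = of_real (sqrt (2 * pi) / ?e * n (w / ?e))" for w
    proof -
      have "of_real (exp (- (w / ?e)\<^sup>2 / 2)) =
          (LINT v|lborel. n v *\<^sub>R exp (\<i> * complex_of_real (- (w / ?e) * v)))"
        unfolding n_def by (subst std_normal_fourier) simp
      also have "\<dots> = \<bar>?e\<bar> *\<^sub>R (LINT y|lborel. n (0 + ?e * y) *\<^sub>R exp (\<i> * complex_of_real (- (w / ?e) * (0 + ?e * y))))"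
        using eps_pos[of j] by (intro lborel_integral_real_affine) simp
      also have "\<dots> = of_real ?e * (LINT y|lborel. of_real (n (?e * y)) * exp (- \<i> * complex_of_real (w * y)))"
        using eps_pos[of j] by (simp add: scaleR_conv_of_real)
      finally show ?thesis
        using eps_pos[of j] by (simp add: n_def std_normal_density_def field_simps del: of_real_exp)
    qed
    have "J j = (LINT y|lborel. LINT s|lborel. f s * (of_real (n (?e * y)) * exp (- \<i> * complex_of_real (t * y)))
         * exp (- \<i> * complex_of_real (y * s)))"
      unfolding J_def
    proof (intro Bochner_Integration.integral_cong refl)
      fix y
      have "n (?e * y) *\<^sub>R (exp (- \<i> * complex_of_real (t * y)) * fourier f y) =
        (of_real (n (?e * y)) * exp (- \<i> * complex_of_real (t * y))) * (LINT s|lborel. exp (- \<i> * complex_of_real (y * s)) * f s)"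
        by (simp add: scaleR_conv_of_real fourier_def)
      also have "\<dots> = (LINT s|lborel. (of_real (n (?e * y)) * exp (- \<i> * complex_of_real (t * y))) * (exp (- \<i> * complex_of_real (y * s)) * f s))"
        by simp
      finally show "n (?e * y) *\<^sub>R (exp (- \<i> * complex_of_real (t * y)) * fourier f y) =
        (LINT s|lborel. f s * (of_real (n (?e * y)) * exp (- \<i> * complex_of_real (t * y))) * exp (- \<i> * complex_of_real (y * s)))"
        by (simp add: mult_ac)
    qed
    also have "\<dots> = (LINT s|lborel. LINT y|lborel. f s * (of_real (n (?e * y)) * exp (- \<i> * complex_of_real (t * y)))
         * exp (- \<i> * complex_of_real (y * s)))"
    proof (rule Fubini_bounded_kernel[OF csmooth_integrable[OF f], symmetric, where B = 1])
      have "integrable lborel (\<lambda>y. complex_of_real (n (?e * y)))" using scaled by simp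
      then show "integrable lborel (\<lambda>y. of_real (n (?e * y)) * exp (- \<i> * complex_of_real (t * y)))"
        by (rule Bochner_Integration.integrable_bound) (auto simp: norm_mult)
    qed auto
    also have "\<dots> = (LINT s|lborel. of_real (sqrt (2 * pi)) * (of_real (n ((s + t) / ?e) / ?e) * f s))"
    proof (intro Bochner_Integration.integral_cong refl)
      fix s
      have "(LINT y|lborel. f s * (of_real (n (?e * y)) * exp (- \<i> * complex_of_real (t * y))) * exp (- \<i> * complex_of_real (y * s)))
        = (LINT y|lborel. f s * (of_real (n (?e * y)) * exp (- \<i> * complex_of_real ((s + t) * y))))"
      proof (intro Bochner_Integration.integral_cong refl)
        fix y
        have "exp (- \<i> * complex_of_real (t * y)) * exp (- \<i> * complex_of_real (y * s)) = exp (- \<i> * complex_of_real ((s + t) * y))"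
          by (simp add: exp_add[symmetric] algebra_simps)
        then show "f s * (of_real (n (?e * y)) * exp (- \<i> * complex_of_real (t * y))) * exp (- \<i> * complex_of_real (y * s)) =
          f s * (of_real (n (?e * y)) * exp (- \<i> * complex_of_real ((s + t) * y)))"
          by (simp only: mult.assoc)
      qed
      also have "\<dots> = f s * (LINT y|lborel. of_real (n (?e * y)) * exp (- \<i> * complex_of_real ((s + t) * y)))"
        by (rule integral_mult_right_zero)
      also have "\<dots> = of_real (sqrt (2 * pi)) * (of_real (n ((s + t) / ?e) / ?e) * f s)"
        unfolding gauss by simp
      finally show "(LINT y|lborel. f s * (of_real (n (?e * y)) * exp (- \<i> * complex_of_real (t * y))) * exp (- \<i> * complex_of_real (y * s)))
        = of_real (sqrt (2 * pi)) * (of_real (n ((s + t) / ?e) / ?e) * f s)" .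
    qed
    also have "\<dots> = of_real (sqrt (2 * pi)) * (LINT s|lborel. of_real (n ((s + t) / ?e) / ?e) * f s)"
      by (rule integral_mult_right_zero)
    also have "(LINT s|lborel. of_real (n ((s + t) / ?e) / ?e) * f s) = \<bar>?e\<bar> *\<^sub>R (LINT v|lborel. of_real (n ((- t + ?e * v + t) / ?e) / ?e) * f (- t + ?e * v))"
      using eps_pos[of j] by (intro lborel_integral_real_affine) simp
    also have "\<dots> = (LINT v|lborel. ?e *\<^sub>R (of_real (n ((- t + ?e * v + t) / ?e) / ?e) * f (- t + ?e * v)))"
      using eps_pos[of j] by simp
    also have "\<dots> = (LINT v|lborel. n v *\<^sub>R f (?e * v - t))"
      using eps_pos[of j] by (intro Bochner_Integration.integral_cong refl) (simp add: scaleR_conv_of_real)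
    finally show ?thesis .
  qed
  have "(\<lambda>j. LINT v|lborel. n v *\<^sub>R f (eps j * v - t)) \<longlonglongrightarrow> (LINT v|lborel. n v *\<^sub>R f (- t))"
  proof -
    have cont: "continuous_on UNIV f" using f by (simp add: csmooth_def smooth_continuous)
    obtain B where B: "norm (f t) \<le> B" for t
      using csmooth_bounded[OF f] by blast
    show ?thesis
    proof (rule integral_dominated_convergence[where w = "\<lambda>v. n v * B"])
      show "integrable lborel (\<lambda>v. n v * B)" using n_int by simp
      show "AE v in lborel. (\<lambda>j. n v *\<^sub>R f (eps j * v - t)) \<longlonglongrightarrow> n v *\<^sub>R f (- t)"
      proof (intro AE_I2 tendsto_scaleR tendsto_const)
        fix v
        have "(\<lambda>j. eps j * v - t) \<longlonglongrightarrow> 0 * v - t" by (intro tendsto_intros eps_lim)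
        then show "(\<lambda>j. f (eps j * v - t)) \<longlonglongrightarrow> f (- t)"
          using cont by (intro isCont_tendsto_compose[of _ f]) (auto simp: continuous_on_eq_continuous_at)
      qed
      show "AE v in lborel. norm (n v *\<^sub>R f (eps j * v - t)) \<le> n v * B" for j
        using B by (intro AE_I2) (simp add: n_nn mult_left_mono)
    qed measurable
  qed
  also have "(LINT v|lborel. n v *\<^sub>R f (- t)) = f (- t)"
    using n_int by (simp add: n_def)
  finally have "J \<longlonglongrightarrow> of_real (sqrt (2 * pi)) * f (- t)"
    unfolding J by (intro tendsto_mult tendsto_const)
  then have "of_real (sqrt (2 * pi)) * f (- t) = (LINT y|lborel. n 0 *\<^sub>R (exp (- \<i> * complex_of_real (t * y)) * fourier f y))"
    using lim1 LIMSEQ_unique by blast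
  also have "\<dots> = n 0 *\<^sub>R fourier (fourier f) t"
    unfolding fourier_def[of "fourier f"] by simp
  also have "n 0 = 1 / sqrt (2 * pi)" by (simp add: n_def std_normal_density_def)
  finally have eq: "of_real (sqrt (2 * pi)) * f (- t) = (1 / sqrt (2 * pi)) *\<^sub>R fourier (fourier f) t" .
  have "fourier (fourier f) t = sqrt (2 * pi) *\<^sub>R ((1 / sqrt (2 * pi)) *\<^sub>R fourier (fourier f) t)"
    by simp
  also have "\<dots> = of_real (sqrt (2 * pi) * sqrt (2 * pi)) * f (- t)"
    unfolding eq[symmetric] by (simp only: scaleR_conv_of_real of_real_mult mult.assoc)
  also have "sqrt (2 * pi) * sqrt (2 * pi) = 2 * pi" by simp
  finally show ?thesis .
qed

section \<open>The averaging kernel\<close>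

lemma integrable_inverse_1_plus_square_UNIV:
  "integrable lborel (\<lambda>x::real. inverse (1 + x\<^sup>2))"
  using integrable_inverse_1_plus_square
  by (simp add: set_integrable_def einterval_def)

text \<open>(1 + |y|)(1 + y^2) expands into the powers |y|^0 to |y|^3, so four decay bounds dominate
  the integrand by a multiple of 1/(1 + y^2). The weight admits averages of functions of linear
  growth.\<close>

lemma integrable_weighted_fourier:
  assumes "csmooth L f" "L \<ge> 0"
  shows "integrable lborel (\<lambda>u. (1 + \<bar>u\<bar>) * norm (fourier f u))"
proof -
  have "\<exists>C. \<forall>y. \<bar>y\<bar> ^ m * norm (fourier f y) \<le> C" for m
    using fourier_decay[OF assms] .
  then obtain C where C: "\<And>m y. \<bar>y\<bar> ^ m * norm (fourier f y) \<le> C m" by metis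
  define D where "D = C 0 + C 1 + C 2 + C 3"
  have bound: "(1 + \<bar>y\<bar>) * norm (fourier f y) \<le> D * inverse (1 + y\<^sup>2)" for y
  proof -
    have "((1 + \<bar>y\<bar>) * norm (fourier f y)) * (1 + y\<^sup>2) =
        \<bar>y\<bar> ^ 0 * norm (fourier f y) + \<bar>y\<bar> ^ 1 * norm (fourier f y) + \<bar>y\<bar> ^ 2 * norm (fourier f y) + \<bar>y\<bar> ^ 3 * norm (fourier f y)"
      by (simp add: algebra_simps power2_eq_square power3_eq_cube abs_mult_self_eq flip: power2_abs[of y])
    also have "\<dots> \<le> D" unfolding D_def by (intro add_mono C)
    finally show ?thesis
      by (simp add: pos_le_divide_eq add_pos_nonneg flip: divide_inverse)
  qed
  have "continuous_on UNIV (fourier f)" using smooth_fourier[OF assms(1)] by (rule smooth_continuous)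
  then have [measurable]: "fourier f \<in> borel_measurable borel" by (rule borel_measurable_continuous_onI)
  have "integrable lborel (\<lambda>x::real. D * inverse (1 + x\<^sup>2))"
    using integrable_inverse_1_plus_square_UNIV by (rule integrable_mult_right)
  then show ?thesis
    by (rule Bochner_Integration.integrable_bound) (use bound in \<open>auto intro!: AE_I2 order_trans[OF bound]\<close>)
qed

lemma integrable_fourier:
  assumes "csmooth L f" "L \<ge> 0"
  shows "integrable lborel (fourier f)"
proof (rule Bochner_Integration.integrable_bound[OF integrable_weighted_fourier[OF assms]])
  show "fourier f \<in> borel_measurable lborel"
    using smooth_fourier[OF assms(1)] smooth_continuous borel_measurable_continuous_onI by auto
  show "AE x in lborel. norm (fourier f x) \<le> norm ((1 + \<bar>x\<bar>) * norm (fourier f x))"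
    by (intro AE_I2) (simp add: abs_mult distrib_right)
qed

lemma fourier_real:
  assumes "\<And>t. f (- t) = f t" "\<And>t. cnj (f t) = f t"
  shows "cnj (fourier f u) = fourier f u"
proof -
  have "cnj (fourier f u) = (LINT t|lborel. cnj (exp (- \<i> * complex_of_real (u * t)) * f t))"
    unfolding fourier_def by (rule Bochner_Integration.integral_cnj[symmetric])
  also have "\<dots> = (LINT t|lborel. exp (- \<i> * complex_of_real (u * (- t))) * f (- t))"
    by (simp add: exp_cnj assms)
  also have "\<dots> = fourier f u"
    unfolding fourier_def by (rule lborel_integral_reflect)
  finally show ?thesis .
qed

text \<open>The bump receives half the radius, so that its autoconvolution stays within [-l, l]. The
  bump is even and real, hence its transform is real and k is the square of a real function; k(0) is
  the square of the positive integral of the bump. Evenness of \<phi> removes the reflection from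
  the inversion formula.\<close>

lemma kernel_exists:
  assumes "l > 0"
  obtains \<phi> k where "csmooth l \<phi>" "\<And>u. fourier \<phi> u = complex_of_real (k u)" "\<And>u. k u \<ge> 0" "k 0 > 0"
    "continuous_on UNIV k" "integrable lborel (\<lambda>u. (1 + \<bar>u\<bar>) * k u)"
    "\<And>t. fourier (fourier \<phi>) t = of_real (2 * pi) * \<phi> t"
proof -
  define b where "b = (\<lambda>t. complex_of_real (bump (l / 2) t))"
  have c: "csmooth (l / 2) b"
    using smooth_bump bump_eq_0 by (simp add: csmooth_def b_def)
  have sym: "b (- t) = b t" "cnj (b t) = b t" for t by (simp_all add: b_def bump_minus)
  define \<phi> where "\<phi> = autoconv (l / 2) b"
  define k where "k = (\<lambda>u. (Re (fourier b u))\<^sup>2)"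
  have F: "fourier b u = complex_of_real (Re (fourier b u))" for u
    using fourier_real[of b u] sym by (simp add: complex_eq_iff)
  have 1: "csmooth l \<phi>" using csmooth_autoconv[OF c] by (simp add: \<phi>_def)
  have 2: "fourier \<phi> u = complex_of_real (k u)" for u
    unfolding \<phi>_def fourier_autoconv[OF c] k_def of_real_power F[symmetric] ..
  have 3: "continuous_on UNIV k"
    unfolding k_def using smooth_continuous[OF smooth_fourier[OF c], of UNIV] by (intro continuous_intros)
  have "0 < (LINT t|lborel. bump (l / 2) t)"
  proof -
    have cont: "continuous_on UNIV (bump (l / 2))"
      using smooth_continuous[OF smooth_bump, of UNIV "l / 2"] by (simp add: continuous_on_of_real_o_iff o_def)
    have int: "integrable lborel (bump (l / 2))"
      using integrable_Re[OF csmooth_integrable[OF c]] unfolding b_def by simp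
    have "open {t. bump (l / 2) t > 0}"
      using cont by (intro open_Collect_less continuous_on_const)
    moreover have "{t. bump (l / 2) t > 0} \<noteq> {}" using bump_pos[of "l / 2"] assms by auto
    ultimately have "emeasure lborel {t. bump (l / 2) t > 0} \<noteq> 0"
      using open_not_negligible by (force simp: negligible_iff_emeasure0)
    then have "\<not> (AE t in lborel. bump (l / 2) t = 0)"
      using bump_nonneg cont borel_measurable_continuous_onI[OF cont]
      by (subst AE_iff_measurable[OF _ refl]) (auto simp: order_less_le)
    then have "(LINT t|lborel. bump (l / 2) t) \<noteq> 0"
      using integral_nonneg_eq_0_iff_AE[OF int] bump_nonneg by auto
    moreover have "(LINT t|lborel. bump (l / 2) t) \<ge> 0" using bump_nonneg by simp
    ultimately show ?thesis by simp
  qed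
  then have 4: "k 0 > 0" unfolding k_def by (simp add: fourier_def b_def)
  have 5: "integrable lborel (\<lambda>u. (1 + \<bar>u\<bar>) * k u)"
    using integrable_weighted_fourier[OF 1] assms unfolding 2 norm_of_real by (simp add: k_def)
  have "\<phi> (- t) = \<phi> t" for t
  proof -
    have "\<phi> (- t) = (LINT s|lborel. b (- s) * b (- t - - s))"
      unfolding \<phi>_def autoconv_lborel[OF c] by (rule lborel_integral_reflect[symmetric])
    also have "\<dots> = \<phi> t"
      unfolding \<phi>_def autoconv_lborel[OF c]
    proof (intro Bochner_Integration.integral_cong refl)
      fix s
      have "- t - - s = - (t - s)" by simp
      then show "b (- s) * b (- t - - s) = b s * b (t - s)" by (simp only: sym(1))
    qed
    finally show ?thesis .
  qed
  then have 6: "fourier (fourier \<phi>) t = of_real (2 * pi) * \<phi> t" for t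
    using fourier_inversion[OF 1 integrable_fourier[OF 1]] assms by simp
  show thesis
    by (rule that[OF 1 2 _ 4 3 5 6]) (simp add: k_def)
qed

section \<open>Real Tauberian estimates\<close>

lemma integrable_kernel_moments:
  fixes k :: "real \<Rightarrow> real"
  assumes k: "\<And>u. 0 \<le> k u" "k \<in> borel_measurable borel" "integrable lborel (\<lambda>u. (1 + \<bar>u\<bar>) * k u)"
  shows "integrable lborel k" "integrable lborel (\<lambda>u. \<bar>u\<bar> * k u)"
  using k by (auto intro!: Bochner_Integration.integrable_bound[OF k(3)] mult_right_mono simp: abs_mult distrib_right)

text \<open>The average is centred at x + H. For u \<ge> -H the point x + H + u is not to the left
  of x, so the decrease condition bounds f there below by f(x) minus a linear cost. For u < -H only
  the weighted bound is available; it is used for f(x) and for f(x + H + u), which costs 2w(1 + |u|)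
  with w = A(1 + \<eta>|x|). The quarter in the tail condition turns this into w times half the
  mass. The tail is two-sided so that the condition survives u -> -u.\<close>

lemma one_sided_bound:
  fixes f k :: "real \<Rightarrow> real"
  assumes f: "f \<in> borel_measurable borel" "\<And>y. \<bar>f y\<bar> \<le> A * (1 + \<eta> * \<bar>y\<bar>)" and \<eta>: "0 \<le> \<eta>" "\<eta> \<le> 1"
    and dec: "\<And>x h. 0 \<le> h \<Longrightarrow> f (x + h) \<ge> f x - C * (1 + h)" and C: "0 \<le> C"
    and k: "\<And>u. 0 \<le> k u" "k \<in> borel_measurable borel" "integrable lborel (\<lambda>u. (1 + \<bar>u\<bar>) * k u)"
    and M: "\<And>x. (LINT y|lborel. f y * k (y - x)) \<le> M"
    and H: "0 \<le> H" "(LINT u|lborel. indicator {u. \<bar>u\<bar> > H} u * ((1 + \<bar>u\<bar>) * k u)) \<le> (LINT u|lborel. k u) / 4"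
  shows "f x * (LINT u|lborel. k u) \<le> M + C * (H * (LINT u|lborel. k u) + (LINT u|lborel. (1 + \<bar>u\<bar>) * k u))
            + A * (1 + \<eta> * \<bar>x\<bar>) * ((LINT u|lborel. k u) / 2)"
proof -
  note [measurable] = f(1) k(2)
  have ki: "integrable lborel k" using integrable_kernel_moments[OF k] by blast
  have A: "0 \<le> A" using f(2)[of 0] by simp
  define w where "w = A * (1 + \<eta> * \<bar>x\<bar>)"
  have w: "0 \<le> w" unfolding w_def using A \<eta> by simp
  \<comment> \<open>Because \<eta> \<le> 1, moving the weight from x to x + v costs a factor 1 + |v|
    that does not depend on \<eta>.\<close>
  have w_mono: "A * (1 + \<eta> * \<bar>x + v\<bar>) \<le> w * (1 + \<bar>v\<bar>)" for v
  proof -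
    have "\<eta> * \<bar>x + v\<bar> \<le> \<eta> * (\<bar>x\<bar> + \<bar>v\<bar>)" using \<eta> by (intro mult_left_mono) auto
    moreover have "\<eta> * \<bar>v\<bar> \<le> \<bar>v\<bar>" using \<eta> by (simp add: mult_left_le_one_le)
    moreover have "0 \<le> \<eta> * \<bar>x\<bar> * \<bar>v\<bar>" using \<eta> by simp
    ultimately have "1 + \<eta> * \<bar>x + v\<bar> \<le> (1 + \<eta> * \<bar>x\<bar>) * (1 + \<bar>v\<bar>)" by (simp add: algebra_simps)
    then show ?thesis unfolding w_def mult.assoc using A by (rule mult_left_mono)
  qed
  let ?I = "\<lambda>u. indicator {u. \<bar>u\<bar> > H} u * ((1 + \<bar>u\<bar>) * k u)"
  have Ii: "integrable lborel ?I"
  proof (rule Bochner_Integration.integrable_bound[OF k(3)])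
    show "AE u in lborel. norm (?I u) \<le> norm ((1 + \<bar>u\<bar>) * k u)"
      by (intro AE_I2) (simp add: indicator_def)
  qed measurable
  have "integrable lborel (\<lambda>u. f (u + (x + H)) * k u)"
  proof (rule Bochner_Integration.integrable_bound)
    show "integrable lborel (\<lambda>u. w * (1 + H) * ((1 + \<bar>u\<bar>) * k u))" using k(3) by (rule integrable_mult_right)
    have "\<bar>f (u + (x + H)) * k u\<bar> \<le> \<bar>w * (1 + H) * ((1 + \<bar>u\<bar>) * k u)\<bar>" for u
    proof -
      have "\<bar>f (u + (x + H))\<bar> \<le> w * (1 + \<bar>H + u\<bar>)"
        using f(2)[of "u + (x + H)"] w_mono[of "H + u"] unfolding add.commute[of u] add.assoc by linarith
      also have "\<dots> \<le> w * ((1 + H) * (1 + \<bar>u\<bar>))"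
      proof (rule mult_left_mono[OF _ w])
        have "0 \<le> H * \<bar>u\<bar>" using H(1) by simp
        then show "1 + \<bar>H + u\<bar> \<le> (1 + H) * (1 + \<bar>u\<bar>)"
        proof -
          have "(1 + H) * (1 + \<bar>u\<bar>) = 1 + H + \<bar>u\<bar> + H * \<bar>u\<bar>" by (simp add: algebra_simps)
          then show ?thesis using H(1) \<open>0 \<le> H * \<bar>u\<bar>\<close> by linarith
        qed
      qed
      finally have "\<bar>f (u + (x + H))\<bar> * k u \<le> w * ((1 + H) * (1 + \<bar>u\<bar>)) * k u"
        using k(1) by (rule mult_right_mono)
      moreover have "\<bar>w * (1 + H) * ((1 + \<bar>u\<bar>) * k u)\<bar> = w * ((1 + H) * (1 + \<bar>u\<bar>)) * k u"
        using k(1)[of u] w H(1) by (simp add: abs_mult mult.assoc)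
      moreover have "\<bar>f (u + (x + H)) * k u\<bar> = \<bar>f (u + (x + H))\<bar> * k u"
        using k(1)[of u] by (simp add: abs_mult)
      ultimately show ?thesis by linarith
    qed
    then show "AE u in lborel. norm (f (u + (x + H)) * k u) \<le> norm (w * (1 + H) * ((1 + \<bar>u\<bar>) * k u))" by simp
  qed measurable
  note lhs_int = this
  have pt: "f x * k u - C * (H * k u + (1 + \<bar>u\<bar>) * k u) - 2 * w * ?I u \<le> f (u + (x + H)) * k u" for u
  proof -
    have *: "f x - C * (H + (1 + \<bar>u\<bar>)) - 2 * w * (indicator {u. \<bar>u\<bar> > H} u * (1 + \<bar>u\<bar>)) \<le> f (u + (x + H))"
    proof (cases "u < - H")
      case True
      then have ind: "indicator {u. \<bar>u\<bar> > H} u = (1::real)" using H(1) by (simp add: indicator_def)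
      \<comment> \<open>For u < -H \<le> 0 the shift by H moves u towards 0, so the tail estimate is
        free of H. This matters because H is chosen from the tail.\<close>
      have "\<bar>H + u\<bar> \<le> \<bar>u\<bar>" using True H(1) by linarith
      then have "w * (1 + \<bar>H + u\<bar>) \<le> w * (1 + \<bar>u\<bar>)" using w by (intro mult_left_mono) auto
      then have 1: "- (w * (1 + \<bar>u\<bar>)) \<le> f (u + (x + H))"
        using f(2)[of "u + (x + H)"] w_mono[of "H + u"] unfolding add.commute[of u] add.assoc by linarith
      have 2: "f x \<le> w * (1 + \<bar>u\<bar>)"
      proof -
        have "f x \<le> w" using f(2)[of x] unfolding w_def by linarith
        also have "w \<le> w * (1 + \<bar>u\<bar>)" using w by (simp add: distrib_left)
        finally show ?thesis .
      qed
      have 3: "0 \<le> C * (H + (1 + \<bar>u\<bar>))" using C H(1) by simp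
      have "2 * w * (1 * (1 + \<bar>u\<bar>)) = 2 * (w * (1 + \<bar>u\<bar>))" by simp
      then show ?thesis using 1 2 3 unfolding ind by linarith
    next
      case False
      have 1: "f x - C * (1 + (H + u)) \<le> f (u + (x + H))"
        using dec[of "H + u" x] False unfolding add.commute[of u] add.assoc by linarith
      have 2: "C * (1 + (H + u)) \<le> C * (H + (1 + \<bar>u\<bar>))" using C by (intro mult_left_mono) auto
      have 3: "0 \<le> 2 * w * (indicator {u. \<bar>u\<bar> > H} u * (1 + \<bar>u\<bar>))" using w by simp
      show ?thesis using 1 2 3 by linarith
    qed
    have eq: "(a - C * (H + q) - 2 * w * (i * q)) * z = a * z - C * (H * z + q * z) - 2 * w * (i * (q * z))" for a q i z
      by (simp add: algebra_simps)
    show ?thesis using mult_right_mono[OF * k(1)[of u]] unfolding eq .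
  qed
  have lin: "integrable lborel (\<lambda>u. a * p u - C * (H * p u + q u) - b * r u)"
    "(LINT u|lborel. a * p u - C * (H * p u + q u) - b * r u) =
      a * (LINT u|lborel. p u) - C * (H * (LINT u|lborel. p u) + (LINT u|lborel. q u)) - b * (LINT u|lborel. r u)"
    if "integrable lborel p" "integrable lborel q" "integrable lborel r" for a b and p q r :: "real \<Rightarrow> real"
    using that by simp_all
  have "f x * (LINT u|lborel. k u) - C * (H * (LINT u|lborel. k u) + (LINT u|lborel. (1 + \<bar>u\<bar>) * k u)) - 2 * w * (LINT u|lborel. ?I u)
     \<le> (LINT u|lborel. f (u + (x + H)) * k u)"
    unfolding lin(2)[OF ki k(3) Ii, symmetric]
    by (rule integral_mono[OF lin(1)[OF ki k(3) Ii] lhs_int pt])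
  also have "\<dots> = (LINT y|lborel. f y * k (y - (x + H)))"
    using lborel_integral_shift[of "\<lambda>u. f (u + (x + H)) * k u" "x + H"] by simp
  also have "\<dots> \<le> M" by (rule M)
  finally have "f x * (LINT u|lborel. k u) \<le> M + C * (H * (LINT u|lborel. k u) + (LINT u|lborel. (1 + \<bar>u\<bar>) * k u)) + 2 * w * (LINT u|lborel. ?I u)"
    by simp
  moreover have "2 * w * (LINT u|lborel. ?I u) \<le> 2 * w * ((LINT u|lborel. k u) / 4)"
    using w H(2) by (intro mult_left_mono) auto
  moreover have "2 * w * ((LINT u|lborel. k u) / 4) = w * ((LINT u|lborel. k u) / 2)" by simp
  ultimately show ?thesis unfolding w_def[symmetric] by linarith
qed

text \<open>One estimate yields both signs: x -> -f(-x) satisfies the same decrease condition, and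
  against the reflected kernel its averages are those of f up to sign and reflection of x. The
  constants Q and \<kappa> do not depend on \<eta>, although the supremum A may.\<close>

lemma bounded_of_bounded_average:
  fixes f k :: "real \<Rightarrow> real"
  assumes f: "f \<in> borel_measurable borel" "\<And>y. \<bar>f y\<bar> \<le> D * (1 + \<bar>y\<bar>)"
    and dec: "\<And>x h. 0 \<le> h \<Longrightarrow> f (x + h) \<ge> f x - C * (1 + h)"
    and k: "\<And>u. 0 \<le> k u" "k \<in> borel_measurable borel" "integrable lborel (\<lambda>u. (1 + \<bar>u\<bar>) * k u)"
    and k_pos: "0 < (LINT u|lborel. k u)"
    and M: "\<And>x. \<bar>LINT y|lborel. f y * k (y - x)\<bar> \<le> M"
  shows "\<exists>B. \<forall>x. \<bar>f x\<bar> \<le> B"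
proof -
  define \<kappa> where "\<kappa> = (LINT u|lborel. k u)"
  define m where "m = (LINT u|lborel. (1 + \<bar>u\<bar>) * k u)"
  note [measurable] = f(1) k(2)
  have C: "0 \<le> C" using dec[of 0 0] by simp
  have m: "0 \<le> m" unfolding m_def using k(1) by (intro integral_nonneg_AE) auto
  have M0: "0 \<le> M" using M[of 0] by linarith
  have "((\<lambda>H. LINT u|lborel. indicator {u. \<bar>u\<bar> > H} u * ((1 + \<bar>u\<bar>) * k u)) \<longlongrightarrow> integral\<^sup>L lborel (\<lambda>u::real. 0)) at_top"
  proof (rule integral_dominated_convergence_at_top[where w = "\<lambda>u. (1 + \<bar>u\<bar>) * k u"])
    show "AE u in lborel. ((\<lambda>H. indicator {u. \<bar>u\<bar> > H} u * ((1 + \<bar>u\<bar>) * k u)) \<longlongrightarrow> 0) at_top"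
    proof (intro AE_I2 tendsto_eventually)
      fix u :: real
      show "\<forall>\<^sub>F H in at_top. indicator {u. \<bar>u\<bar> > H} u * ((1 + \<bar>u\<bar>) * k u) = 0"
        using eventually_ge_at_top[of "\<bar>u\<bar>"] by eventually_elim (simp add: indicator_def)
    qed
    show "\<forall>\<^sub>F H in at_top. AE u in lborel. norm (indicator {u. \<bar>u\<bar> > H} u * ((1 + \<bar>u\<bar>) * k u)) \<le> (1 + \<bar>u\<bar>) * k u"
      using k(1) by (intro always_eventually allI AE_I2) (simp add: indicator_def)
  qed (use k in auto)
  then have "\<forall>\<^sub>F H in at_top. (LINT u|lborel. indicator {u. \<bar>u\<bar> > H} u * ((1 + \<bar>u\<bar>) * k u)) < \<kappa> / 4"
    using k_pos by (intro order_tendstoD) (auto simp: \<kappa>_def)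
  then have "\<forall>\<^sub>F H in at_top. 0 \<le> H \<and> (LINT u|lborel. indicator {u. \<bar>u\<bar> > H} u * ((1 + \<bar>u\<bar>) * k u)) < \<kappa> / 4"
    using eventually_ge_at_top[of 0] by eventually_elim simp
  then obtain H where H: "0 \<le> H" "(LINT u|lborel. indicator {u. \<bar>u\<bar> > H} u * ((1 + \<bar>u\<bar>) * k u)) \<le> \<kappa> / 4"
    by (metis (no_types, lifting) eventually_at_top_linorder order_refl less_imp_le)
  define Q where "Q = M + C * (H * \<kappa> + m)"
  have \<kappa>: "0 < \<kappa>" using k_pos by (simp add: \<kappa>_def)
  have Q: "0 \<le> Q" unfolding Q_def using M0 C H m \<kappa> by simp
  have rk: "(LINT u|lborel. k (- u)) = \<kappa>" "(LINT u|lborel. (1 + \<bar>u\<bar>) * k (- u)) = m"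
    "(LINT u|lborel. indicator {u. \<bar>u\<bar> > H} u * ((1 + \<bar>u\<bar>) * k (- u))) = (LINT u|lborel. indicator {u. \<bar>u\<bar> > H} u * ((1 + \<bar>u\<bar>) * k u))"
    using lborel_integral_reflect[of k] lborel_integral_reflect[of "\<lambda>u. (1 + \<bar>u\<bar>) * k u"]
      lborel_integral_reflect[of "\<lambda>u. indicator {u. \<bar>u\<bar> > H} u * ((1 + \<bar>u\<bar>) * k u)"]
    by (simp_all add: \<kappa>_def m_def indicator_def)
  have rk_int: "integrable lborel (\<lambda>u. (1 + \<bar>u\<bar>) * k (- u))"
    using lborel_integrable_real_affine[OF k(3), of "-1" 0] by simp
  have main: "\<bar>f x\<bar> \<le> 2 * Q / \<kappa> * (1 + \<eta> * \<bar>x\<bar>)" if \<eta>: "0 < \<eta>" "\<eta> \<le> 1" for \<eta> x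
  proof -
    let ?w = "\<lambda>y. 1 + \<eta> * \<bar>y\<bar>"
    have w1: "1 \<le> ?w y" for y using \<eta> by simp
    \<comment> \<open>The linear bound on f makes this supremum finite, at most D/\<eta>. Finiteness
      is what later allows A/2 to be subtracted from both sides.\<close>
    define A where "A = (SUP y. \<bar>f y\<bar> / ?w y)"
    have D: "0 \<le> D" using f(2)[of 0] by simp
    have "\<bar>f y\<bar> / ?w y \<le> D / \<eta>" for y
    proof -
      have "\<eta> * (1 + \<bar>y\<bar>) \<le> ?w y" using \<eta> by (simp add: distrib_left)
      then have "1 + \<bar>y\<bar> \<le> ?w y / \<eta>" using \<eta> by (simp add: pos_le_divide_eq mult.commute)
      then have "D * (1 + \<bar>y\<bar>) \<le> D * (?w y / \<eta>)" using D by (rule mult_left_mono)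
      then have "\<bar>f y\<bar> \<le> D / \<eta> * ?w y" using f(2)[of y] by simp
      then show ?thesis using w1[of y] by (simp add: pos_divide_le_eq)
    qed
    then have bdd: "bdd_above (range (\<lambda>y. \<bar>f y\<bar> / ?w y))" by (intro bdd_aboveI) auto
    have A: "\<bar>f y\<bar> \<le> A * ?w y" for y
    proof -
      have "\<bar>f y\<bar> / ?w y \<le> A" unfolding A_def by (rule cSUP_upper[OF _ bdd]) simp
      then show ?thesis using w1[of y] by (simp add: pos_divide_le_eq)
    qed
    have up: "f y * \<kappa> \<le> Q + A * ?w y * (\<kappa> / 2)" for y
    proof -
      have "(LINT z|lborel. f z * k (z - x)) \<le> M" for x using M[of x] by linarith
      from one_sided_bound[OF f(1) A _ \<eta>(2) dec C k this H(1) H(2)[unfolded \<kappa>_def]]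
      show ?thesis using \<eta> unfolding Q_def \<kappa>_def m_def by simp
    qed
    have down: "- f y * \<kappa> \<le> Q + A * ?w y * (\<kappa> / 2)" for y
    proof -
      have 1: "(LINT z|lborel. - f (- z) * k (- (z - x))) \<le> M" for x
      proof -
        have "(LINT z|lborel. - f (- z) * k (- (z - x))) = - (LINT z|lborel. f z * k (z - (- x)))"
          using lborel_integral_reflect[of "\<lambda>z. f z * k (z - (- x))"] by (simp add: algebra_simps)
        then show ?thesis using M[of "- x"] by linarith
      qed
      have "- f (- (- y)) * (LINT u|lborel. k (- u)) \<le> M + C * (H * (LINT u|lborel. k (- u)) + (LINT u|lborel. (1 + \<bar>u\<bar>) * k (- u)))
            + A * (1 + \<eta> * \<bar>- y\<bar>) * ((LINT u|lborel. k (- u)) / 2)"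
      proof (rule one_sided_bound[where f = "\<lambda>x. - f (- x)" and k = "\<lambda>u. k (- u)"])
        show "- f (- (x + h)) \<ge> - f (- x) - C * (1 + h)" if "0 \<le> h" for x h
          using dec[OF that, of "- (x + h)"] by (simp add: algebra_simps)
        show "(LINT u|lborel. indicator {u. \<bar>u\<bar> > H} u * ((1 + \<bar>u\<bar>) * k (- u))) \<le> (LINT u|lborel. k (- u)) / 4"
          unfolding rk using H by simp
        show "\<bar>- f (- y)\<bar> \<le> A * (1 + \<eta> * \<bar>y\<bar>)" for y using A[of "- y"] by simp
        show "(\<lambda>x. - f (- x)) \<in> borel_measurable borel" "(\<lambda>u. k (- u)) \<in> borel_measurable borel"
          by measurable
        show "0 \<le> k (- u)" for u by (rule k)
      qed (fact 1 rk_int C H(1) less_imp_le[OF \<eta>(1)] \<eta>(2))+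
      then show ?thesis unfolding rk Q_def by simp
    qed
    have "\<bar>f y\<bar> / ?w y \<le> Q / \<kappa> + A / 2" for y
    proof -
      have "\<bar>f y\<bar> * \<kappa> \<le> Q + A * ?w y * (\<kappa> / 2)" using up[of y] down[of y] by (simp add: abs_if)
      also have "\<dots> \<le> Q * ?w y + A * ?w y * (\<kappa> / 2)" using Q w1[of y] mult_left_mono[OF w1[of y] Q] by simp
      finally have "\<bar>f y\<bar> \<le> (Q / \<kappa> + A / 2) * ?w y" using \<kappa> by (simp add: field_simps)
      then show ?thesis using w1[of y] by (simp add: pos_divide_le_eq)
    qed
    then have "A \<le> Q / \<kappa> + A / 2" unfolding A_def by (intro cSUP_least) auto
    then have "A \<le> 2 * Q / \<kappa>" by simp
    then have "A * ?w x \<le> 2 * Q / \<kappa> * ?w x" using w1[of x] by (intro mult_right_mono) auto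
    then show ?thesis using A[of x] by linarith
  qed
  have "\<bar>f x\<bar> \<le> 2 * Q / \<kappa>" for x
  proof (rule tendsto_lowerbound)
    show "((\<lambda>\<eta>. 2 * Q / \<kappa> * (1 + \<eta> * \<bar>x\<bar>)) \<longlongrightarrow> 2 * Q / \<kappa>) (at_right 0)"
      using \<kappa> by (auto intro!: tendsto_eq_intros)
    show "\<forall>\<^sub>F \<eta> in at_right 0. \<bar>f x\<bar> \<le> 2 * Q / \<kappa> * (1 + \<eta> * \<bar>x\<bar>)"
      using main by (auto simp: eventually_at_right_field intro!: exI[of _ 1])
  qed auto
  then show ?thesis by blast
qed

section \<open>A priori growth bounds\<close>

text \<open>If v = c \<rho>(x) - C is positive, then \<rho> \<ge> v on the window [x, x + \<delta>],
  and the integral over it is at least \<delta> v e^{-\<epsilon>(x + \<delta>)}. The two constants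
  cover both Tauberian conditions: c = 1 for bounded decrease, C = 0 for the monotone one.\<close>

lemma exponential_growth:
  fixes \<rho> :: "real \<Rightarrow> real"
  assumes int: "\<And>a b. set_integrable lborel {a..b} (\<lambda>y. \<rho> y * exp (- (\<epsilon> * y)))" and \<epsilon>: "\<epsilon> > 0"
    and B: "\<And>x. x \<ge> X \<Longrightarrow> (LINT y:{x..x+\<delta>}|lborel. \<rho> y * exp (- (\<epsilon> * y))) \<le> B"
    and growth: "\<And>x h. X \<le> x \<Longrightarrow> 0 \<le> h \<Longrightarrow> h \<le> \<delta> \<Longrightarrow> \<rho> (x + h) \<ge> c * \<rho> x - C"
    and pos: "X \<ge> 0" "\<delta> > 0" "c > 0" "C \<ge> 0"
  shows "\<exists>E. \<forall>x\<ge>X. \<rho> x \<le> E * exp (\<epsilon> * x)"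
proof (intro exI allI impI)
  fix x assume x: "X \<le> x"
  define v where "v = c * \<rho> x - C"
  have e1: "1 \<le> exp (\<epsilon> * x)" using x pos \<epsilon> by simp
  have "v \<le> \<bar>B\<bar> * exp (\<epsilon> * \<delta>) / \<delta> * exp (\<epsilon> * x)"
  proof (cases "v \<le> 0")
    case True
    also have "0 \<le> \<bar>B\<bar> * exp (\<epsilon> * \<delta>) / \<delta> * exp (\<epsilon> * x)" using pos by simp
    finally show ?thesis .
  next
    case False
    have "v * exp (- (\<epsilon> * (x + \<delta>))) * \<delta> = (LINT y:{x..x+\<delta>}|lborel. v * exp (- (\<epsilon> * (x + \<delta>))))"
      using pos by (simp add: set_lebesgue_integral_def)
    also have "\<dots> \<le> (LINT y:{x..x+\<delta>}|lborel. \<rho> y * exp (- (\<epsilon> * y)))"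
    proof (rule set_integral_mono[OF _ int])
      show "set_integrable lborel {x..x+\<delta>} (\<lambda>y. v * exp (- (\<epsilon> * (x + \<delta>))))"
        by (intro borel_integrable_atLeastAtMost' continuous_on_const)
      fix y assume y: "y \<in> {x..x+\<delta>}"
      have "v \<le> \<rho> y" using growth[of x "y - x"] x y by (simp add: v_def)
      moreover have "exp (- (\<epsilon> * (x + \<delta>))) \<le> exp (- (\<epsilon> * y))" using y \<epsilon> by simp
      ultimately show "v * exp (- (\<epsilon> * (x + \<delta>))) \<le> \<rho> y * exp (- (\<epsilon> * y))"
        using False by (intro mult_mono) auto
    qed
    also have "\<dots> \<le> \<bar>B\<bar>" using B[OF x] by simp
    finally have "v * exp (- (\<epsilon> * (x + \<delta>))) * \<delta> * exp (\<epsilon> * (x + \<delta>)) \<le> \<bar>B\<bar> * exp (\<epsilon> * (x + \<delta>))"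
      by (intro mult_right_mono) auto
    also have "v * exp (- (\<epsilon> * (x + \<delta>))) * \<delta> * exp (\<epsilon> * (x + \<delta>)) = v * \<delta> * (exp (- (\<epsilon> * (x + \<delta>))) * exp (\<epsilon> * (x + \<delta>)))"
      by (simp only: mult_ac)
    also have "\<dots> = v * \<delta>" by (simp flip: exp_add)
    finally have "v * \<delta> \<le> \<bar>B\<bar> * exp (\<epsilon> * (x + \<delta>))" .
    then show ?thesis using pos by (simp add: field_simps exp_add)
  qed
  moreover have "C \<le> C * exp (\<epsilon> * x)" using e1 pos mult_left_mono[OF e1, of C] by simp
  ultimately have "c * \<rho> x \<le> (C + \<bar>B\<bar> * exp (\<epsilon> * \<delta>) / \<delta>) * exp (\<epsilon> * x)"
    unfolding v_def distrib_right by linarith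
  then show "\<rho> x \<le> (C + \<bar>B\<bar> * exp (\<epsilon> * \<delta>) / \<delta>) / c * exp (\<epsilon> * x)"
    using pos by (simp add: pos_le_divide_eq mult.commute)
qed

text \<open>On the window [x, x + \<delta>] the function is at least c \<rho>(x) - C; elsewhere
  beyond X it loses at most D(1 + y), and [0, X] contributes a fixed error. So the average about x
  controls \<rho>(x) for each \<sigma> > 0, and in the limit \<open>T x\<close> does. The form of
  the bound is chosen so that D = 0 gives a constant.\<close>

lemma linear_growth:
  fixes \<rho> k :: "real \<Rightarrow> real"
  assumes loc: "\<And>a b. set_integrable lborel {a..b} \<rho>" and neg: "\<And>y. y < 0 \<Longrightarrow> \<rho> y = 0"
    and exp_int: "\<And>\<sigma>. \<sigma> > 0 \<Longrightarrow> integrable lborel (\<lambda>y. \<rho> y * exp (- (\<sigma> * y)))"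
    and k: "\<And>u. 0 \<le> k u" "k \<in> borel_measurable borel" "integrable lborel (\<lambda>u. (1 + \<bar>u\<bar>) * k u)"
    and k_bdd: "\<And>u. k u \<le> Kb" and k_pos: "0 < (LINT u:{0..\<delta>}|lborel. k u)"
    and lim: "\<And>x. ((\<lambda>\<sigma>. LINT y|lborel. \<rho> y * exp (- (\<sigma> * y)) * k (y - x)) \<longlongrightarrow> T x) (at_right 0)"
    and T: "\<And>x. T x \<le> M"
    and growth: "\<And>x h. X \<le> x \<Longrightarrow> 0 \<le> h \<Longrightarrow> h \<le> \<delta> \<Longrightarrow> \<rho> (x + h) \<ge> c * \<rho> x - C"
    and low: "\<And>y. X \<le> y \<Longrightarrow> \<rho> y \<ge> - (D * (1 + y))"
    and pos: "X \<ge> 0" "c > 0" "C \<ge> 0" "D \<ge> 0"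
  shows "\<exists>E\<ge>0. \<forall>x\<ge>X. \<rho> x \<le> E * (1 + D * (1 + x))"
proof -
  note ki = integrable_kernel_moments(1)[OF k]
  define m where "m = (LINT u|lborel. (1 + \<bar>u\<bar>) * k u)"
  define k1 where "k1 = (LINT u:{0..\<delta>}|lborel. k u)"
  define I0 where "I0 = (LINT y:{0..X}|lborel. \<bar>\<rho> y\<bar>)"
  have k1: "0 < k1" using k_pos by (simp add: k1_def)
  have Kb: "0 \<le> Kb" using k(1)[of 0] k_bdd[of 0] by linarith
  have m: "0 \<le> m" unfolding m_def using k(1) by (intro integral_nonneg_AE) auto
  have I0: "0 \<le> I0" unfolding I0_def set_lebesgue_integral_def by (intro integral_nonneg_AE) auto
  define E where "E = (C + (\<bar>M\<bar> + Kb * I0) / k1 + m / k1) / c"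
  have E: "0 \<le> E" unfolding E_def using pos Kb I0 m k1 by simp
  have "\<rho> x \<le> E * (1 + D * (1 + x))" if x: "X \<le> x" for x
  proof -
    define v where "v = c * \<rho> x - C"
    have x0: "0 \<le> x" using x pos by simp
    have v_le: "v \<le> (\<bar>M\<bar> + Kb * I0 + D * (1 + x) * m) / k1"
    proof (cases "v \<le> 0")
      case True
      also have "0 \<le> (\<bar>M\<bar> + Kb * I0 + D * (1 + x) * m) / k1" using Kb I0 m k1 pos x0 by simp
      finally show ?thesis .
    next
      case False
      then have v: "0 < v" by simp
      let ?J = "\<lambda>y. indicator {x..x+\<delta>} y * k (y - x)"
      let ?w = "\<lambda>y. (1 + \<bar>y - x\<bar>) * k (y - x)"
      let ?r = "\<lambda>y. indicator {0..X} y * \<bar>\<rho> y\<bar>"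
      have J_eq: "?J y = indicator {0..\<delta>} (y - x) * k (y - x)" for y by (auto simp: indicator_def)
      have J_int: "integrable lborel ?J"
      proof -
        have "integrable lborel (\<lambda>u. indicator {0..\<delta>} u * k u)"
          by (rule Bochner_Integration.integrable_bound[OF ki]) (use k in \<open>auto simp: indicator_def\<close>)
        from lborel_integrable_shift[OF this, of x] show ?thesis unfolding J_eq .
      qed
      have J: "(LINT y|lborel. ?J y) = k1"
        unfolding J_eq using lborel_integral_shift[of "\<lambda>u. indicator {0..\<delta>} u * k u" x]
        by (simp add: k1_def set_lebesgue_integral_def)
      have w_int: "integrable lborel ?w" using lborel_integrable_shift[OF k(3), of x] .
      have w: "(LINT y|lborel. ?w y) = m"
        using lborel_integral_shift[of "\<lambda>u. (1 + \<bar>u\<bar>) * k u" x] by (simp add: m_def)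
      have r_int: "integrable lborel ?r"
        using set_integrable_abs[OF loc[of 0 X]] by (simp add: set_integrable_def)
      have r: "(LINT y|lborel. ?r y) = I0"
        by (simp add: I0_def set_lebesgue_integral_def)
      have lower: "exp (- (\<sigma> * (x + \<delta>))) * v * k1 - D * (1 + x) * m - Kb * I0
          \<le> (LINT y|lborel. \<rho> y * exp (- (\<sigma> * y)) * k (y - x))" if \<sigma>: "\<sigma> > 0" for \<sigma>
      proof -
        \<comment> \<open>The damping is taken at x + \<delta>, its smallest value on the window,
          which is a valid lower bound since v > 0. Elsewhere on y \<ge> 0 it is at most 1, and
          beyond X the comparison 1 + y \<le> (1 + x)(1 + |y - x|) moves the loss to the first
          moment of the kernel about x.\<close>
        have pt: "exp (- (\<sigma> * (x + \<delta>))) * v * ?J y - D * (1 + x) * ?w y - Kb * ?r y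
            \<le> \<rho> y * exp (- (\<sigma> * y)) * k (y - x)" for y
        proof -
          have w0: "0 \<le> D * (1 + x) * ?w y" using pos x0 k(1)[of "y - x"] by simp
          have r0: "0 \<le> Kb * ?r y" using Kb by simp
          have e1: "exp (- (\<sigma> * y)) \<le> 1" if "0 \<le> y" using that \<sigma> by simp
          consider "y < 0" | "0 \<le> y" "y < X" | "X \<le> y" "y \<notin> {x..x+\<delta>}" | "X \<le> y" "y \<in> {x..x+\<delta>}" by fastforce
          then show ?thesis
          proof cases
            case 1
            then have J0: "?J y = 0" using x0 by (simp add: indicator_def)
            have "exp (- (\<sigma> * (x + \<delta>))) * v * ?J y = 0" unfolding J0 by simp
            moreover have "\<rho> y * exp (- (\<sigma> * y)) * k (y - x) = 0" using neg[OF 1] by simp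
            ultimately show ?thesis using w0 r0 by linarith
          next
            case 2
            then have J0: "?J y = 0" "?r y = \<bar>\<rho> y\<bar>" using x by (simp_all add: indicator_def)
            have "exp (- (\<sigma> * y)) * k (y - x) \<le> 1 * Kb"
              using e1[OF 2(1)] k k_bdd by (intro mult_mono) auto
            then have "\<bar>\<rho> y\<bar> * (exp (- (\<sigma> * y)) * k (y - x)) \<le> \<bar>\<rho> y\<bar> * (1 * Kb)"
              by (rule mult_left_mono) simp
            moreover have "\<bar>\<rho> y * exp (- (\<sigma> * y)) * k (y - x)\<bar> = \<bar>\<rho> y\<bar> * (exp (- (\<sigma> * y)) * k (y - x))"
              using k(1)[of "y - x"] by (simp add: abs_mult mult.assoc)
            ultimately have "\<bar>\<rho> y * exp (- (\<sigma> * y)) * k (y - x)\<bar> \<le> Kb * ?r y" unfolding J0 by (simp add: mult.commute)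
            then show ?thesis using w0 unfolding J0(1) by linarith
          next
            case 3
            then have J0: "?J y = 0" by (simp add: indicator_def)
            have y0: "0 \<le> y" using 3 pos by simp
            let ?z = "exp (- (\<sigma> * y)) * k (y - x)"
            have z: "0 \<le> ?z" "?z \<le> k (y - x)"
              using k(1)[of "y - x"] e1[OF y0] by (simp_all add: mult_left_le_one_le)
            have "- (\<rho> y) * ?z \<le> D * (1 + y) * ?z"
              using low[OF 3(1)] z(1) by (intro mult_right_mono) auto
            also have "\<dots> \<le> D * (1 + y) * k (y - x)"
              using pos y0 z(2) by (intro mult_left_mono) auto
            also have "\<dots> \<le> D * ((1 + x) * (1 + \<bar>y - x\<bar>)) * k (y - x)"
            proof (intro mult_right_mono mult_left_mono pos k)
              have "0 \<le> x * \<bar>y - x\<bar>" using x0 by simp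
              moreover have "(1 + x) * (1 + \<bar>y - x\<bar>) = 1 + x + \<bar>y - x\<bar> + x * \<bar>y - x\<bar>" by (simp add: algebra_simps)
              ultimately show "1 + y \<le> (1 + x) * (1 + \<bar>y - x\<bar>)" by linarith
            qed
            also have "\<dots> = D * (1 + x) * ?w y" by (simp only: mult.assoc)
            finally have "- (\<rho> y) * ?z \<le> D * (1 + x) * ?w y" .
            moreover have "- (\<rho> y) * ?z = - (\<rho> y * exp (- (\<sigma> * y)) * k (y - x))" by simp
            ultimately show ?thesis using r0 unfolding J0 by linarith
          next
            case 4
            then have J0: "?J y = k (y - x)" by (simp add: indicator_def)
            have "v \<le> \<rho> y" using growth[of x "y - x"] x 4 by (simp add: v_def)
            moreover have "exp (- (\<sigma> * (x + \<delta>))) \<le> exp (- (\<sigma> * y))" using 4 \<sigma> by simp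
            ultimately have "v * exp (- (\<sigma> * (x + \<delta>))) * k (y - x) \<le> \<rho> y * exp (- (\<sigma> * y)) * k (y - x)"
              using v k(1) by (intro mult_right_mono mult_mono) auto
            moreover have "v * exp (- (\<sigma> * (x + \<delta>))) * k (y - x) = exp (- (\<sigma> * (x + \<delta>))) * v * ?J y" unfolding J0 by simp
            ultimately show ?thesis using w0 r0 by linarith
          qed
        qed
        have lin: "integrable lborel (\<lambda>u. a * p u - b * q u - d * s u)"
          "(LINT u|lborel. a * p u - b * q u - d * s u) = a * (LINT u|lborel. p u) - b * (LINT u|lborel. q u) - d * (LINT u|lborel. s u)"
          if "integrable lborel p" "integrable lborel q" "integrable lborel s" for a b d and p q s :: "real \<Rightarrow> real"
          using that by simp_all
        have "integrable lborel (\<lambda>y. \<rho> y * exp (- (\<sigma> * y)) * k (y - x))"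
        proof (rule Bochner_Integration.integrable_bound)
          show "integrable lborel (\<lambda>y. Kb * (\<rho> y * exp (- (\<sigma> * y))))"
            by (intro integrable_mult_right exp_int \<sigma>)
          show "(\<lambda>y. \<rho> y * exp (- (\<sigma> * y)) * k (y - x)) \<in> borel_measurable lborel"
            using k(2) borel_measurable_integrable[OF exp_int[OF \<sigma>]] by measurable
          show "AE y in lborel. norm (\<rho> y * exp (- (\<sigma> * y)) * k (y - x)) \<le> norm (Kb * (\<rho> y * exp (- (\<sigma> * y))))"
          proof (rule AE_I2)
            fix y
            have "\<bar>\<rho> y * exp (- (\<sigma> * y))\<bar> * k (y - x) \<le> \<bar>\<rho> y * exp (- (\<sigma> * y))\<bar> * Kb"
              using k_bdd by (intro mult_left_mono) auto
            then show "norm (\<rho> y * exp (- (\<sigma> * y)) * k (y - x)) \<le> norm (Kb * (\<rho> y * exp (- (\<sigma> * y))))"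
              using k(1)[of "y - x"] Kb by (simp add: abs_mult mult.commute)
          qed
        qed
        from integral_mono[OF lin(1)[OF J_int w_int r_int] this pt]
        show ?thesis unfolding lin(2)[OF J_int w_int r_int] J w r .
      qed
      have "((\<lambda>\<sigma>. exp (- (\<sigma> * (x + \<delta>))) * v * k1 - D * (1 + x) * m - Kb * I0) \<longlongrightarrow>
          exp (- (0 * (x + \<delta>))) * v * k1 - D * (1 + x) * m - Kb * I0) (at_right 0)"
        by (intro tendsto_intros)
      moreover have "\<forall>\<^sub>F \<sigma> in at_right 0. exp (- (\<sigma> * (x + \<delta>))) * v * k1 - D * (1 + x) * m - Kb * I0
          \<le> (LINT y|lborel. \<rho> y * exp (- (\<sigma> * y)) * k (y - x))"
        using eventually_at_right_less[of "0::real"] by eventually_elim (rule lower)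
      ultimately have "exp (- (0 * (x + \<delta>))) * v * k1 - D * (1 + x) * m - Kb * I0 \<le> T x"
        by (intro tendsto_le[OF _ lim[of x]]) auto
      then have "v * k1 - D * (1 + x) * m - Kb * I0 \<le> T x" by simp
      then have "v * k1 \<le> \<bar>M\<bar> + Kb * I0 + D * (1 + x) * m" using T[of x] by linarith
      then show ?thesis using k1 by (simp add: pos_le_divide_eq)
    qed
    have t: "0 \<le> D * (1 + x)" using pos x0 by simp
    have "c * \<rho> x \<le> C + (\<bar>M\<bar> + Kb * I0) / k1 + D * (1 + x) * (m / k1)"
      using v_le unfolding v_def by (simp add: add_divide_distrib)
    also have "\<dots> \<le> (C + (\<bar>M\<bar> + Kb * I0) / k1 + m / k1) * (1 + D * (1 + x))"
    proof -
      have "0 \<le> (C + (\<bar>M\<bar> + Kb * I0) / k1) * (D * (1 + x))" "0 \<le> m / k1"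
        using t pos Kb I0 k1 m by simp_all
      moreover have "(a + b) * (1 + z) = a + b + a * z + z * b" for a b z :: real by (simp add: algebra_simps)
      ultimately show ?thesis by simp
    qed
    also have "\<dots> = c * (E * (1 + D * (1 + x)))" using pos by (simp add: E_def)
    finally show ?thesis using pos by simp
  qed
  with E show ?thesis by blast
qed

text \<open>The interval from x to x + h is crossed in at most 1 + h/\<delta> steps of length at
  most \<delta>, each losing at most C.\<close>

lemma additive_decrease:
  fixes \<rho> :: "real \<Rightarrow> real"
  assumes step: "\<And>x h. X \<le> x \<Longrightarrow> 0 \<le> h \<Longrightarrow> h \<le> \<delta> \<Longrightarrow> \<rho> (x + h) \<ge> \<rho> x - C"
    and "\<delta> > 0" "C \<ge> 0" "X \<le> x" "0 \<le> h"
  shows "\<rho> (x + h) \<ge> \<rho> x - C * (1 + h / \<delta>)"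
proof -
  have *: "\<rho> (x + h) \<ge> \<rho> x - C * real n" if "X \<le> x" "0 \<le> h" "h \<le> real n * \<delta>" for n x h
    using that
  proof (induction n arbitrary: x h)
    case 0
    then show ?case by simp
  next
    case (Suc n)
    define h' where "h' = min h \<delta>"
    have "\<rho> (x + h' + (h - h')) \<ge> \<rho> (x + h') - C * real n"
      using Suc.prems assms(2) by (intro Suc.IH) (auto simp: h'_def min_def algebra_simps)
    moreover have "\<rho> (x + h') \<ge> \<rho> x - C"
      using Suc.prems assms(2) by (intro step) (auto simp: h'_def)
    ultimately show ?case by (simp add: algebra_simps)
  qed
  define n where "n = nat \<lceil>h / \<delta>\<rceil>"
  have n: "h / \<delta> \<le> real n" "real n \<le> 1 + h / \<delta>"
    using assms by (simp_all add: n_def of_nat_ceiling) linarith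
  have "\<rho> (x + h) \<ge> \<rho> x - C * real n"
    using assms n(1) by (intro *) (simp_all add: pos_divide_le_eq)
  moreover have "C * real n \<le> C * (1 + h / \<delta>)" using n(2) assms by (intro mult_left_mono)
  ultimately show ?thesis by linarith
qed

text \<open>\<open>linear_growth\<close> with c = 1 supplies the majorant that admits \<sigma> = 0.
  The absorption argument wants the decrease condition on the whole line, so \<rho> is cut off to 0
  before X, which changes the averages by a bounded amount only.\<close>

lemma bounded_if_decrease_controlled:
  fixes \<rho> k :: "real \<Rightarrow> real"
  assumes loc: "\<And>a b. set_integrable lborel {a..b} \<rho>" and neg: "\<And>y. y < 0 \<Longrightarrow> \<rho> y = 0"
    and exp_int: "\<And>\<sigma>. \<sigma> > 0 \<Longrightarrow> integrable lborel (\<lambda>y. \<rho> y * exp (- (\<sigma> * y)))"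
    and k: "\<And>u. 0 \<le> k u" "k \<in> borel_measurable borel" "integrable lborel (\<lambda>u. (1 + \<bar>u\<bar>) * k u)"
    and k_bdd: "\<And>u. k u \<le> Kb" and k_pos: "0 < (LINT u:{0..\<delta>}|lborel. k u)"
    and lim: "\<And>x. ((\<lambda>\<sigma>. LINT y|lborel. \<rho> y * exp (- (\<sigma> * y)) * k (y - x)) \<longlongrightarrow> T x) (at_right 0)"
    and T: "\<And>x. \<bar>T x\<bar> \<le> M"
    and step: "\<And>x h. X \<le> x \<Longrightarrow> 0 \<le> h \<Longrightarrow> h \<le> \<delta> \<Longrightarrow> \<rho> (x + h) \<ge> \<rho> x - C"
    and pos: "X \<ge> 0" "\<delta> > 0" "C \<ge> 0"
  shows "\<exists>B. \<forall>x\<ge>X. \<bar>\<rho> x\<bar> \<le> B"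
proof -
  \<comment> \<open>C + C/\<delta> makes C(1 + h/\<delta>) at most C'(1 + h). The term |\<rho>(X)|
    pays for the starting value in the linear lower bound and for the jump that the cut-off creates
    at X.\<close>
  define C' where "C' = C + C / \<delta> + \<bar>\<rho> X\<bar>"
  have C': "0 \<le> C'" using pos by (simp add: C'_def)
  have dec: "\<rho> (x + h) \<ge> \<rho> x - (C + C / \<delta>) * (1 + h)" if "X \<le> x" "0 \<le> h" for x h
  proof -
    have "(C + C / \<delta>) * (1 + h) = C * (1 + h / \<delta>) + C * h + C / \<delta>" using pos by (simp add: field_simps)
    moreover have "0 \<le> C * h" "0 \<le> C / \<delta>" using pos that by simp_all
    ultimately show ?thesis using additive_decrease[OF step pos(2,3) that] by linarith
  qed
  have low: "\<rho> y \<ge> - (C' * (1 + y))" if "X \<le> y" for y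
  proof -
    have "\<rho> y \<ge> \<rho> X - (C + C / \<delta>) * (1 + (y - X))" using dec[of X "y - X"] that by simp
    moreover have "(C + C / \<delta>) * (1 + (y - X)) \<le> (C + C / \<delta>) * (1 + y)" using pos by (intro mult_left_mono) auto
    moreover have "\<bar>\<rho> X\<bar> \<le> \<bar>\<rho> X\<bar> * (1 + y)" using mult_left_mono[of 1 "1 + y" "\<bar>\<rho> X\<bar>"] that pos by simp
    moreover have "C' * (1 + y) = (C + C / \<delta>) * (1 + y) + \<bar>\<rho> X\<bar> * (1 + y)" by (simp only: C'_def distrib_right)
    ultimately show ?thesis by linarith
  qed
  have "\<exists>E\<ge>0. \<forall>x\<ge>X. \<rho> x \<le> E * (1 + C' * (1 + x))"
  proof (rule linear_growth[OF loc neg exp_int k k_bdd k_pos lim])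
    show "T x \<le> M" for x using T[of x] by linarith
    show "1 * \<rho> x - C \<le> \<rho> (x + h)" if "X \<le> x" "0 \<le> h" "h \<le> \<delta>" for x h using step[OF that] by simp
  qed (use low pos C' in auto)
  then obtain E where E: "E \<ge> 0" "\<And>x. X \<le> x \<Longrightarrow> \<rho> x \<le> E * (1 + C' * (1 + x))" by blast
  define D where "D = C' + E * (1 + C')"
  have D: "0 \<le> D" using C' E by (simp add: D_def)
  have \<rho>_lin: "\<bar>\<rho> y\<bar> \<le> D * (1 + \<bar>y\<bar>)" if "X \<le> y" for y
  proof -
    have y: "0 \<le> y" using that pos by simp
    have "1 + C' * (1 + y) \<le> (1 + C') * (1 + y)" using y by (simp add: distrib_right)
    then have "E * (1 + C' * (1 + y)) \<le> E * ((1 + C') * (1 + y))" using E(1) by (rule mult_left_mono)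
    moreover have "0 \<le> C' * (1 + y)" "0 \<le> E * ((1 + C') * (1 + y))" using C' E y by simp_all
    moreover have "D * (1 + \<bar>y\<bar>) = C' * (1 + y) + E * ((1 + C') * (1 + y))"
      using y by (simp only: D_def distrib_right abs_of_nonneg mult.assoc)
    ultimately show ?thesis using E(2)[OF that] low[OF that] by linarith
  qed
  have \<rho>_meas: "\<rho> \<in> borel_measurable borel"
  proof -
    have [measurable]: "(\<lambda>y. \<rho> y * exp (- (1 * y))) \<in> borel_measurable borel"
      using borel_measurable_integrable[OF exp_int[of 1]] by simp
    have "(\<lambda>y. \<rho> y * exp (- (1 * y)) * exp y) \<in> borel_measurable borel" by measurable
    then show ?thesis by (simp add: mult.assoc flip: exp_add)
  qed
  note [measurable] = \<rho>_meas k(2)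
  define f where "f = (\<lambda>y. if X \<le> y then \<rho> y else 0)"
  define r where "r = (\<lambda>y. indicator {0..X} y * \<bar>\<rho> y\<bar>)"
  have r_int: "integrable lborel r"
    using set_integrable_abs[OF loc[of 0 X]] by (simp add: set_integrable_def r_def)
  have Kb: "0 \<le> Kb" using k(1)[of 0] k_bdd[of 0] by linarith
  have \<rho>_split: "\<bar>\<rho> y - f y\<bar> \<le> r y" for y
    using neg[of y] by (auto simp: f_def r_def indicator_def)
  have f_lin: "\<bar>f y\<bar> \<le> D * (1 + \<bar>y\<bar>)" for y
    using \<rho>_lin[of y] D by (auto simp: f_def)
  \<comment> \<open>A majorant independent of the damping. Linear growth about 0 becomes a first
    moment about x through 1 + |y| \<le> (1 + |x|)(1 + |y - x|), and \<open>r\<close> covers [0, X],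
    where local integrability is used instead.\<close>
  define W where "W = (\<lambda>x y. (D * (1 + \<bar>x\<bar>)) * ((1 + \<bar>y - x\<bar>) * k (y - x)) + Kb * r y)"
  have W_int: "integrable lborel (W x)" for x
    unfolding W_def using lborel_integrable_shift[OF k(3), of x] r_int by (intro Bochner_Integration.integrable_add integrable_mult_right)
  have fk: "\<bar>f y * k (y - x)\<bar> \<le> (D * (1 + \<bar>x\<bar>)) * ((1 + \<bar>y - x\<bar>) * k (y - x))" for x y
  proof -
    have "1 + \<bar>y\<bar> \<le> (1 + \<bar>x\<bar>) * (1 + \<bar>y - x\<bar>)"
    proof -
      have "(1 + \<bar>x\<bar>) * (1 + \<bar>y - x\<bar>) = 1 + \<bar>x\<bar> + \<bar>y - x\<bar> + \<bar>x\<bar> * \<bar>y - x\<bar>" by (simp add: algebra_simps)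
      moreover have "0 \<le> \<bar>x\<bar> * \<bar>y - x\<bar>" by simp
      ultimately show ?thesis by linarith
    qed
    then have "D * (1 + \<bar>y\<bar>) \<le> D * ((1 + \<bar>x\<bar>) * (1 + \<bar>y - x\<bar>))" using D by (rule mult_left_mono)
    then have "\<bar>f y\<bar> \<le> D * ((1 + \<bar>x\<bar>) * (1 + \<bar>y - x\<bar>))" using f_lin[of y] by linarith
    then have "\<bar>f y\<bar> * k (y - x) \<le> D * ((1 + \<bar>x\<bar>) * (1 + \<bar>y - x\<bar>)) * k (y - x)"
      using k(1) by (rule mult_right_mono)
    moreover have "\<bar>f y * k (y - x)\<bar> = \<bar>f y\<bar> * k (y - x)" using k(1)[of "y - x"] by (simp add: abs_mult)
    ultimately show ?thesis by (simp only: mult.assoc)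
  qed
  have rk: "\<bar>(\<rho> y - f y) * k (y - x)\<bar> \<le> Kb * r y" for x y
  proof -
    have "\<bar>\<rho> y - f y\<bar> * k (y - x) \<le> r y * Kb"
      using \<rho>_split k k_bdd by (intro mult_mono) (auto simp: r_def)
    then show ?thesis using k(1)[of "y - x"] by (simp add: abs_mult mult.commute)
  qed
  have W: "\<bar>\<rho> y * k (y - x)\<bar> \<le> W x y" for x y
  proof -
    have "\<rho> y * k (y - x) = f y * k (y - x) + (\<rho> y - f y) * k (y - x)" by (simp add: left_diff_distrib)
    then show ?thesis using fk[of y x] rk[of y x] unfolding W_def by linarith
  qed
  \<comment> \<open>To use dominated convergence for sequences, \<sigma> runs through 1/(j + 1). On
    y \<ge> 0 the damping is at most 1, and for y < 0 the integrand is 0.\<close>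
  have conv: "(LINT y|lborel. \<rho> y * k (y - x)) = T x" for x
  proof (rule LIMSEQ_unique)
    define s where "s = (\<lambda>j. inverse (real (Suc j)))"
    have s_lim: "s \<longlonglongrightarrow> 0" unfolding s_def by (rule LIMSEQ_inverse_real_of_nat)
    have s_pos: "0 < s j" for j by (simp add: s_def)
    have "filterlim s (at_right 0) sequentially"
      using s_lim s_pos by (simp add: filterlim_at less_imp_neq[OF s_pos, symmetric])
    then show "(\<lambda>j. LINT y|lborel. \<rho> y * exp (- (s j * y)) * k (y - x)) \<longlonglongrightarrow> T x"
      by (rule filterlim_compose[OF lim])
    show "(\<lambda>j. LINT y|lborel. \<rho> y * exp (- (s j * y)) * k (y - x)) \<longlonglongrightarrow> (LINT y|lborel. \<rho> y * k (y - x))"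
    proof (rule integral_dominated_convergence[OF _ _ W_int])
      show "AE y in lborel. (\<lambda>j. \<rho> y * exp (- (s j * y)) * k (y - x)) \<longlonglongrightarrow> \<rho> y * k (y - x)"
      proof (rule AE_I2)
        fix y
        have "(\<lambda>j. \<rho> y * exp (- (s j * y)) * k (y - x)) \<longlonglongrightarrow> \<rho> y * exp (- (0 * y)) * k (y - x)"
          by (intro tendsto_intros s_lim)
        then show "(\<lambda>j. \<rho> y * exp (- (s j * y)) * k (y - x)) \<longlonglongrightarrow> \<rho> y * k (y - x)" by simp
      qed
      show "AE y in lborel. norm (\<rho> y * exp (- (s j * y)) * k (y - x)) \<le> W x y" for j
      proof (rule AE_I2)
        fix y
        show "norm (\<rho> y * exp (- (s j * y)) * k (y - x)) \<le> W x y"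
        proof (cases "y < 0")
          case True
          then show ?thesis using neg[OF True] W[of y x] by simp
        next
          case False
          then have "exp (- (s j * y)) \<le> 1" using s_pos[of j] by simp
          then have "\<bar>\<rho> y * k (y - x)\<bar> * exp (- (s j * y)) \<le> \<bar>\<rho> y * k (y - x)\<bar> * 1"
            by (rule mult_left_mono) simp
          then show ?thesis using W[of y x] by (simp add: abs_mult mult_ac)
        qed
      qed
    qed measurable
  qed
  have "\<bar>LINT y|lborel. f y * k (y - x)\<bar> \<le> M + Kb * (LINT y|lborel. r y)" for x
  proof -
    have [measurable]: "f \<in> borel_measurable borel" unfolding f_def by measurable
    have i1: "integrable lborel (\<lambda>y. \<rho> y * k (y - x))"
      by (rule Bochner_Integration.integrable_bound[OF W_int[of x]]) (use W in \<open>auto intro: order_trans[OF W abs_ge_self]\<close>)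
    have i3: "integrable lborel (\<lambda>y. Kb * r y)" using r_int by simp
    have i2: "integrable lborel (\<lambda>y. (\<rho> y - f y) * k (y - x))"
      by (rule Bochner_Integration.integrable_bound[OF i3]) (auto intro: order_trans[OF rk abs_ge_self])
    have "f y * k (y - x) = \<rho> y * k (y - x) - (\<rho> y - f y) * k (y - x)" for y by (simp add: left_diff_distrib)
    then have "(LINT y|lborel. f y * k (y - x)) = T x - (LINT y|lborel. (\<rho> y - f y) * k (y - x))"
      using Bochner_Integration.integral_diff[OF i1 i2] conv[of x] by (simp only:)
    moreover have "\<bar>LINT y|lborel. (\<rho> y - f y) * k (y - x)\<bar> \<le> (LINT y|lborel. Kb * r y)"
      by (rule order_trans[OF integral_norm_bound[of lborel "\<lambda>y. (\<rho> y - f y) * k (y - x)", unfolded real_norm_def]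
            integral_mono[OF integrable_abs[OF i2] i3 rk]])
    moreover have "(LINT y|lborel. Kb * r y) = Kb * (LINT y|lborel. r y)" by simp
    ultimately show ?thesis using T[of x] by linarith
  qed
  moreover have "f (x + h) \<ge> f x - C' * (1 + h)" if h: "0 \<le> h" for x h
  proof -
    have 0: "0 \<le> C' * (1 + h)" using C' h by simp
    have coef: "(C + C / \<delta>) * (1 + h) \<le> C' * (1 + h)" using h by (intro mult_right_mono) (auto simp: C'_def)
    \<comment> \<open>The delicate case is the one that crosses X: f starts at 0, and its fall is at
      most the decrease of \<rho> after X plus |\<rho>(X)|.\<close>
    consider "X \<le> x" | "x < X" "X \<le> x + h" | "x + h < X" by linarith
    then show ?thesis
    proof cases
      case 1
      then have "f x = \<rho> x" "f (x + h) = \<rho> (x + h)" using h by (simp_all add: f_def)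
      then show ?thesis using dec[OF 1 h] coef by linarith
    next
      case 2
      have "\<rho> (X + (x + h - X)) \<ge> \<rho> X - (C + C / \<delta>) * (1 + (x + h - X))" using 2 by (intro dec) auto
      moreover have "(C + C / \<delta>) * (1 + (x + h - X)) \<le> (C + C / \<delta>) * (1 + h)" using 2 pos by (intro mult_left_mono) auto
      moreover have "\<bar>\<rho> X\<bar> \<le> \<bar>\<rho> X\<bar> * (1 + h)" using mult_left_mono[of 1 "1 + h" "\<bar>\<rho> X\<bar>"] h by simp
      moreover have "C' * (1 + h) = (C + C / \<delta>) * (1 + h) + \<bar>\<rho> X\<bar> * (1 + h)" by (simp only: C'_def distrib_right)
      ultimately have "\<rho> (x + h) \<ge> - (C' * (1 + h))" by simp
      then show ?thesis using 2 by (simp add: f_def)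
    next
      case 3
      then show ?thesis using 0 h by (simp add: f_def)
    qed
  qed
  moreover have "0 < (LINT u|lborel. k u)"
  proof -
    have ki: "integrable lborel k" by (rule integrable_kernel_moments(1)[OF k])
    have "(LINT u:{0..\<delta>}|lborel. k u) \<le> (LINT u|lborel. k u)"
      unfolding set_lebesgue_integral_def
    proof (rule integral_mono[OF _ ki])
      show "integrable lborel (\<lambda>u. indicator {0..\<delta>} u *\<^sub>R k u)"
        by (rule Bochner_Integration.integrable_bound[OF ki]) (auto simp: indicator_def)
    qed (use k(1) in \<open>simp add: indicator_def\<close>)
    then show ?thesis using k_pos by linarith
  qed
  moreover have "f \<in> borel_measurable borel" unfolding f_def by measurable
  ultimately obtain B where "\<And>x. \<bar>f x\<bar> \<le> B"
    using bounded_of_bounded_average[of f D C' k "M + Kb * (LINT y|lborel. r y)"] f_lin k by blast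
  then show ?thesis unfolding f_def by (metis (mono_tags))
qed

lemma bdd_decreasing_realE:
  assumes "bdd_decreasing_real \<rho>"
  obtains \<delta> X C where "\<delta> > 0" "X \<ge> 0" "C \<ge> 0"
    "\<And>x h. X \<le> x \<Longrightarrow> 0 \<le> h \<Longrightarrow> h \<le> \<delta> \<Longrightarrow> \<rho> (x + h) \<ge> \<rho> x - C"
proof -
  obtain \<delta> where \<delta>: "\<delta> > 0" "Liminf at_top (\<lambda>x. INF h\<in>{0..\<delta>}. ereal (\<rho> (x + h) - \<rho> x)) > - \<infinity>"
    using assms unfolding bdd_decreasing_real_def by blast
  then obtain c where c: "ereal c < Liminf at_top (\<lambda>x. INF h\<in>{0..\<delta>}. ereal (\<rho> (x + h) - \<rho> x))"
    using ereal_dense2 by blast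
  have "\<forall>\<^sub>F x in at_top. ereal c < (INF h\<in>{0..\<delta>}. ereal (\<rho> (x + h) - \<rho> x))"
    using c by (rule less_LiminfD)
  then obtain X where X: "\<And>x. X \<le> x \<Longrightarrow> ereal c < (INF h\<in>{0..\<delta>}. ereal (\<rho> (x + h) - \<rho> x))"
    unfolding eventually_at_top_linorder by blast
  show thesis
  proof (rule that[of \<delta> "max X 0" "\<bar>c\<bar>"])
    fix x h assume x: "max X 0 \<le> x" and h: "0 \<le> h" "h \<le> \<delta>"
    have "ereal c < (INF h\<in>{0..\<delta>}. ereal (\<rho> (x + h) - \<rho> x))" using X x by simp
    also have "\<dots> \<le> ereal (\<rho> (x + h) - \<rho> x)" using h by (intro INF_lower) auto
    finally show "\<rho> (x + h) \<ge> \<rho> x - \<bar>c\<bar>" by simp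
  qed (use \<delta> in auto)
qed

section \<open>Absolute convergence of the Laplace integral\<close>

lemma set_integrable_mult_exp:
  fixes \<rho> :: "real \<Rightarrow> real"
  assumes "set_integrable lborel {a..b} \<rho>"
  shows "set_integrable lborel {a..b} (\<lambda>y. \<rho> y * exp (- (s * y)))"
proof -
  have "integrable lborel (\<lambda>y. exp (\<bar>s\<bar> * (\<bar>a\<bar> + \<bar>b\<bar>)) * (indicator {a..b} y *\<^sub>R \<rho> y))"
    using assms unfolding set_integrable_def by (rule integrable_mult_right)
  then show ?thesis
    unfolding set_integrable_def
  proof (rule Bochner_Integration.integrable_bound)
    have "(\<lambda>y. (indicator {a..b} y *\<^sub>R \<rho> y) * exp (- (s * y))) \<in> borel_measurable lborel"
      using borel_measurable_integrable[OF assms[unfolded set_integrable_def]] by measurable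
    then show "(\<lambda>y. indicator {a..b} y *\<^sub>R (\<rho> y * exp (- (s * y)))) \<in> borel_measurable lborel"
      by (simp add: mult.assoc)
    show "AE y in lborel. norm (indicator {a..b} y *\<^sub>R (\<rho> y * exp (- (s * y))))
        \<le> norm (exp (\<bar>s\<bar> * (\<bar>a\<bar> + \<bar>b\<bar>)) * (indicator {a..b} y *\<^sub>R \<rho> y))"
    proof (rule AE_I2)
      fix y
      have "exp (- (s * y)) \<le> exp (\<bar>s\<bar> * (\<bar>a\<bar> + \<bar>b\<bar>))" if "y \<in> {a..b}"
      proof -
        have "- (s * y) \<le> \<bar>s\<bar> * \<bar>y\<bar>" using abs_ge_minus_self[of "s * y"] by (simp add: abs_mult)
        also have "\<dots> \<le> \<bar>s\<bar> * (\<bar>a\<bar> + \<bar>b\<bar>)" using that by (intro mult_left_mono) auto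
        finally show ?thesis by simp
      qed
      then have "\<bar>\<rho> y\<bar> * exp (- (s * y)) \<le> \<bar>\<rho> y\<bar> * exp (\<bar>s\<bar> * (\<bar>a\<bar> + \<bar>b\<bar>))" if "y \<in> {a..b}"
        using that by (intro mult_left_mono) auto
      then show "norm (indicator {a..b} y *\<^sub>R (\<rho> y * exp (- (s * y))))
        \<le> norm (exp (\<bar>s\<bar> * (\<bar>a\<bar> + \<bar>b\<bar>)) * (indicator {a..b} y *\<^sub>R \<rho> y))"
        by (cases "y \<in> {a..b}") (simp_all add: abs_mult mult.commute)
    qed
  qed
qed

text \<open>Half of \<sigma> is spent on growth. Convergence at \<epsilon> = \<sigma>/2 bounds the
  window integrals, since two partial integrals within 1 of their limit differ by at most 2.
  \<open>exponential_growth\<close> then bounds \<rho> above by a multiple of e^{\<epsilon>y}, and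
  \<open>low\<close> takes the other side. After multiplication by e^{-\<sigma>y} the integrable
  factor e^{-\<epsilon>y} remains.\<close>

lemma absolutely_convergent_laplace:
  fixes \<rho> :: "real \<Rightarrow> real"
  assumes loc: "\<And>a b. set_integrable lborel {a..b} \<rho>" and neg: "\<And>y. y < 0 \<Longrightarrow> \<rho> y = 0"
    and conv: "\<And>s. s > 0 \<Longrightarrow> \<exists>L. ((\<lambda>T. LINT y:{0..T}|lborel. \<rho> y * exp (- (s * y))) \<longlongrightarrow> L) at_top"
    and growth: "\<And>x h. X \<le> x \<Longrightarrow> 0 \<le> h \<Longrightarrow> h \<le> \<delta> \<Longrightarrow> \<rho> (x + h) \<ge> c * \<rho> x - C"
    and low: "\<And>y. X \<le> y \<Longrightarrow> \<rho> y \<ge> - (D * (1 + y))"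
    and pos: "X \<ge> 0" "\<delta> > 0" "c > 0" "C \<ge> 0" "D \<ge> 0"
    and \<sigma>: "\<sigma> > 0"
  shows "integrable lborel (\<lambda>y. \<rho> y * exp (- (\<sigma> * y)))"
proof -
  define \<epsilon> where "\<epsilon> = \<sigma> / 2"
  have \<epsilon>: "\<epsilon> > 0" using \<sigma> by (simp add: \<epsilon>_def)
  let ?f = "\<lambda>y. \<rho> y * exp (- (\<epsilon> * y))"
  let ?R = "\<lambda>T. LINT y:{0..T}|lborel. ?f y"
  have int: "set_integrable lborel {a..b} ?f" for a b by (intro set_integrable_mult_exp loc)
  obtain L where L: "(?R \<longlongrightarrow> L) at_top" using conv[OF \<epsilon>] by blast
  have "\<forall>\<^sub>F T in at_top. dist (?R T) L < 1" using tendstoD[OF L] by simp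
  then obtain X0 where X0: "\<And>T. X0 \<le> T \<Longrightarrow> dist (?R T) L < 1"
    unfolding eventually_at_top_linorder by blast
  define X1 where "X1 = max X X0"
  have X1: "X1 \<ge> 0" "X \<le> X1" "X0 \<le> X1" using pos by (auto simp: X1_def)
  have "\<exists>E. \<forall>x\<ge>X1. \<rho> x \<le> E * exp (\<epsilon> * x)"
  proof (rule exponential_growth[OF int \<epsilon> _ growth X1(1) pos(2,3,4)])
    fix x assume x: "X1 \<le> x"
    have HK: "(LINT y:{a..b}|lborel. ?f y) = integral {a..b} ?f" "?f integrable_on {a..b}" for a b
      using set_borel_integral_eq_integral[OF int] by auto
    have "?R x + (LINT y:{x..x+\<delta>}|lborel. ?f y) = ?R (x + \<delta>)"
      unfolding HK(1) using x X1 pos HK(2) by (intro Henstock_Kurzweil_Integration.integral_combine) auto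
    moreover have "dist (?R x) L < 1" "dist (?R (x + \<delta>)) L < 1" using x X1 pos by (auto intro!: X0)
    ultimately show "(LINT y:{x..x+\<delta>}|lborel. ?f y) \<le> 2" by (simp add: dist_real_def abs_if split: if_splits)
  qed (use X1 in auto)
  then obtain E where E: "\<And>x. x \<ge> X1 \<Longrightarrow> \<rho> x \<le> E * exp (\<epsilon> * x)" by blast
  define E' where "E' = \<bar>E\<bar> + D * (1 + 1 / \<epsilon>)"
  have "\<bar>\<rho> y\<bar> \<le> E' * exp (\<epsilon> * y)" if y: "y \<ge> X1" for y
  proof -
    have y0: "0 \<le> y" using y X1 by simp
    have e1: "1 + \<epsilon> * y \<le> exp (\<epsilon> * y)" by (rule exp_ge_add_one_self)
    have "1 \<le> exp (\<epsilon> * y)" using y0 \<epsilon> by simp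
    moreover have "y \<le> 1 / \<epsilon> * exp (\<epsilon> * y)"
    proof -
      have "\<epsilon> * y \<le> exp (\<epsilon> * y)" using e1 by linarith
      then show ?thesis using \<epsilon> by (simp add: pos_le_divide_eq mult.commute)
    qed
    ultimately have "1 + y \<le> (1 + 1 / \<epsilon>) * exp (\<epsilon> * y)" unfolding distrib_right by linarith
    then have "D * (1 + y) \<le> D * ((1 + 1 / \<epsilon>) * exp (\<epsilon> * y))" using pos(5) by (rule mult_left_mono)
    moreover have "E * exp (\<epsilon> * y) \<le> \<bar>E\<bar> * exp (\<epsilon> * y)" by (intro mult_right_mono) auto
    moreover have "0 \<le> \<bar>E\<bar> * exp (\<epsilon> * y)" "0 \<le> D * (1 + y)" using pos y0 by auto
    moreover have "E' * exp (\<epsilon> * y) = \<bar>E\<bar> * exp (\<epsilon> * y) + D * ((1 + 1 / \<epsilon>) * exp (\<epsilon> * y))"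
      by (simp only: E'_def distrib_right mult.assoc)
    ultimately show ?thesis using E[OF y] low[of y] y X1 by linarith
  qed
  note \<rho>_le = this
  define W where "W = (\<lambda>y. indicator {0..X1} y *\<^sub>R \<bar>\<rho> y * exp (- (\<sigma> * y))\<bar> + \<bar>E'\<bar> * (indicator {0<..} y *\<^sub>R exp (- (y * \<epsilon>))))"
  have "integrable lborel W"
    unfolding W_def
    using set_integrable_abs[OF set_integrable_mult_exp[OF loc]] integrable_I0i_exp_mscale[OF \<epsilon>]
    by (intro Bochner_Integration.integrable_add integrable_mult_right) (simp_all add: set_integrable_def)
  then show ?thesis
  proof (rule Bochner_Integration.integrable_bound)
    show "(\<lambda>y. \<rho> y * exp (- (\<sigma> * y))) \<in> borel_measurable lborel"
    \<comment> \<open>The assumption is local integrability, so measurability on the line is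
      obtained from the truncations to [-n, n].\<close>
    proof (rule borel_measurable_LIMSEQ_real)
      show "(\<lambda>n. indicator {- real n..real n} y *\<^sub>R (\<rho> y * exp (- (\<sigma> * y)))) \<longlonglongrightarrow> \<rho> y * exp (- (\<sigma> * y))" for y
      proof (rule tendsto_eventually)
        obtain N where "\<bar>y\<bar> \<le> real N" using real_arch_simple by blast
        then show "\<forall>\<^sub>F n in sequentially. indicator {- real n..real n} y *\<^sub>R (\<rho> y * exp (- (\<sigma> * y))) = \<rho> y * exp (- (\<sigma> * y))"
          unfolding eventually_sequentially by (intro exI[of _ N]) (auto simp: indicator_def)
      qed
      show "(\<lambda>y. indicator {- real n..real n} y *\<^sub>R (\<rho> y * exp (- (\<sigma> * y)))) \<in> borel_measurable lborel" for n
        using set_integrable_mult_exp[OF loc] unfolding set_integrable_def by (rule borel_measurable_integrable)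
    qed
    show "AE y in lborel. norm (\<rho> y * exp (- (\<sigma> * y))) \<le> norm (W y)"
    proof (rule AE_I2)
      fix y
      have W0: "0 \<le> W y" by (simp add: W_def)
      consider "y < 0" | "0 \<le> y" "y \<le> X1" | "X1 < y" by linarith
      then show "norm (\<rho> y * exp (- (\<sigma> * y))) \<le> norm (W y)"
      proof cases
        case 1
        then show ?thesis using neg by simp
      next
        case 2
        then show ?thesis by (auto simp: W_def indicator_def)
      next
        case 3
        have "\<bar>\<rho> y * exp (- (\<sigma> * y))\<bar> \<le> E' * exp (\<epsilon> * y) * exp (- (\<sigma> * y))"
          using \<rho>_le[of y] 3 by (simp add: abs_mult)
        also have "\<dots> = E' * exp (- (y * \<epsilon>))"
        proof -
          have "\<epsilon> * y + - (\<sigma> * y) = - (y * \<epsilon>)" by (simp add: \<epsilon>_def field_simps)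
          then show ?thesis by (simp add: mult.assoc flip: exp_add)
        qed
        also have "\<dots> \<le> \<bar>E'\<bar> * exp (- (y * \<epsilon>))" by (intro mult_right_mono) auto
        also have "\<dots> = W y" using 3 X1 by (simp add: W_def indicator_def)
        finally show ?thesis using W0 by simp
      qed
    qed
  qed
qed

text \<open>The growth condition compares \<rho>(x) with values to its right, so the mass that
  counts is the one on [0, \<delta>]. By continuity k stays above k(0)/2 on some [0, r].\<close>

lemma kernel_mass_pos:
  fixes k :: "real \<Rightarrow> real"
  assumes "continuous_on UNIV k" "\<And>u. 0 \<le> k u" "0 < k 0" "0 < \<delta>"
  shows "0 < (LINT u:{0..\<delta>}|lborel. k u)"
proof -
  have "isCont k 0" using assms(1) by (simp add: continuous_on_eq_continuous_at)
  then obtain d where d: "d > 0" "\<And>u. dist u 0 < d \<Longrightarrow> dist (k u) (k 0) < k 0 / 2"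
    using assms(3) unfolding continuous_at_eps_delta by (metis half_gt_zero dist_real_def)
  define r where "r = min (d / 2) \<delta>"
  have r: "r > 0" "r \<le> \<delta>" "r < d" using d assms by (auto simp: r_def)
  have "0 < r * (k 0 / 2)" using r assms by simp
  also have "\<dots> = (LINT u:{0..r}|lborel. k 0 / 2)" using r by (simp add: set_lebesgue_integral_def)
  also have "\<dots> \<le> (LINT u:{0..\<delta>}|lborel. k u)"
    unfolding set_lebesgue_integral_def
  proof (rule integral_mono)
    show "integrable lborel (\<lambda>u. indicator {0..r} u *\<^sub>R (k 0 / 2))"
      using borel_integrable_atLeastAtMost'[of 0 r "\<lambda>_. k 0 / 2"] by (simp add: set_integrable_def)
    show "integrable lborel (\<lambda>u. indicator {0..\<delta>} u *\<^sub>R k u)"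
      using borel_integrable_atLeastAtMost'[OF continuous_on_subset[OF assms(1)], of 0 \<delta>] by (simp add: set_integrable_def)
    fix u
    show "indicator {0..r} u *\<^sub>R (k 0 / 2) \<le> indicator {0..\<delta>} u *\<^sub>R k u"
    proof (cases "u \<in> {0..r}")
      case True
      then have "dist (k u) (k 0) < k 0 / 2" using r by (intro d) (auto simp: dist_real_def)
      then have "k 0 / 2 \<le> k u" by (simp add: dist_real_def abs_if split: if_splits)
      then show ?thesis using True r by (simp add: indicator_def)
    next
      case False
      then show ?thesis using assms(2)[of u] by (auto simp: indicator_def)
    qed
  qed
  finally show ?thesis .
qed

section \<open>Boundary values and averages\<close>

lemma laplace_eq_integral:
  assumes neg: "\<And>x. x < 0 \<Longrightarrow> \<tau> x = 0"
    and int: "integrable lborel (\<lambda>y. \<tau> y * exp (- s * complex_of_real y))"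
  shows "laplace \<tau> s = (LINT y|lborel. \<tau> y * exp (- s * complex_of_real y))"
  unfolding laplace_def
proof (rule tendsto_Lim)
  let ?f = "\<lambda>y. \<tau> y * exp (- s * complex_of_real y)"
  have "((\<lambda>T. LINT y|lborel. indicator {0..T} y *\<^sub>R ?f y) \<longlongrightarrow> (LINT y|lborel. ?f y)) at_top"
  proof (rule integral_dominated_convergence_at_top[where w = "\<lambda>y. norm (?f y)"])
    note [measurable] = borel_measurable_integrable[OF int]
    show "(\<lambda>y. indicator {0..T} y *\<^sub>R ?f y) \<in> borel_measurable lborel" for T :: real by measurable
    show "AE y in lborel. ((\<lambda>T. indicator {0..T} y *\<^sub>R ?f y) \<longlongrightarrow> ?f y) at_top"
    proof (intro AE_I2 tendsto_eventually)
      fix y :: real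
      show "\<forall>\<^sub>F T in at_top. indicator {0..T} y *\<^sub>R ?f y = ?f y"
        using eventually_ge_at_top[of y] by eventually_elim (use neg[of y] in \<open>auto simp: indicator_def\<close>)
    qed
    show "\<forall>\<^sub>F T in at_top. AE y in lborel. norm (indicator {0..T} y *\<^sub>R ?f y) \<le> norm (?f y)"
      by (intro always_eventually allI AE_I2) (simp add: indicator_def)
  qed (use int in auto)
  then show "(laplace_partial \<tau> s \<longlongrightarrow> (LINT y|lborel. ?f y)) at_top"
    unfolding laplace_partial_def[abs_def] set_lebesgue_integral_def .
qed simp

text \<open>After the exchange of integrals the inner integral is the transform of \<phi>, moved
  from y to y - x by the modulation. Absolute convergence at \<sigma> is what licenses the
  exchange.\<close>

lemma pairing_eq_average:
  assumes neg: "\<And>x. x < 0 \<Longrightarrow> \<tau> x = 0"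
    and int: "integrable lborel (\<lambda>y. \<tau> y * of_real (exp (- (\<sigma> * y))))"
    and \<phi>: "csmooth l \<phi>" "\<And>u. fourier \<phi> u = complex_of_real (k u)"
  shows "(LINT t|lborel. laplace \<tau> (Complex \<sigma> t) * (exp (\<i> * of_real x * of_real t) * \<phi> t)) =
    (LINT y|lborel. \<tau> y * of_real (exp (- (\<sigma> * y)) * k (y - x)))"
proof -
  define a where "a = (\<lambda>t. exp (\<i> * of_real x * of_real t) * \<phi> t)"
  define b where "b = (\<lambda>y. \<tau> y * of_real (exp (- (\<sigma> * y))))"
  define e where "e = (\<lambda>t y. exp (- \<i> * complex_of_real (t * y)))"
  have e_split: "exp (- Complex \<sigma> t * complex_of_real y) = of_real (exp (- (\<sigma> * y))) * e t y" for t y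
  proof -
    have "- Complex \<sigma> t * complex_of_real y = of_real (- (\<sigma> * y)) + (- \<i> * complex_of_real (t * y))"
      by (simp add: complex_eq_iff)
    then show ?thesis unfolding e_def by (simp only: exp_add exp_of_real)
  qed
  have a_int: "integrable lborel a"
    unfolding a_def by (intro csmooth_integrable[of l] csmooth_mult smooth_exp \<phi>)
  have b_int: "integrable lborel b" using int by (simp add: b_def)
  have e_meas: "case_prod e \<in> borel_measurable (lborel \<Otimes>\<^sub>M lborel)" unfolding e_def by measurable
  have e_norm: "norm (e t y) = 1" for t y by (simp add: e_def)
  have [measurable]: "b \<in> borel_measurable borel" using borel_measurable_integrable[OF b_int] by simp
  have L: "laplace \<tau> (Complex \<sigma> t) = (LINT y|lborel. b y * e t y)" for t
  proof -
    have eq: "\<tau> y * exp (- Complex \<sigma> t * complex_of_real y) = b y * e t y" for y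
      unfolding e_split b_def by (simp only: mult.assoc)
    have "integrable lborel (\<lambda>y. b y * e t y)"
    proof (rule Bochner_Integration.integrable_bound[OF b_int])
      show "(\<lambda>y. b y * e t y) \<in> borel_measurable lborel" unfolding e_def by measurable
    qed (simp add: norm_mult e_norm)
    then show ?thesis
      using laplace_eq_integral[of \<tau> "Complex \<sigma> t", OF neg] unfolding eq by blast
  qed
  have "(LINT t|lborel. laplace \<tau> (Complex \<sigma> t) * a t) = (LINT t|lborel. LINT y|lborel. a t * b y * e t y)"
  proof (intro Bochner_Integration.integral_cong refl)
    fix t
    have "laplace \<tau> (Complex \<sigma> t) * a t = a t * (LINT y|lborel. b y * e t y)" unfolding L by (rule mult.commute)
    also have "\<dots> = (LINT y|lborel. a t * (b y * e t y))" by (rule integral_mult_right_zero[symmetric])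
    finally show "laplace \<tau> (Complex \<sigma> t) * a t = (LINT y|lborel. a t * b y * e t y)" by (simp only: mult.assoc)
  qed
  also have "\<dots> = (LINT y|lborel. LINT t|lborel. a t * b y * e t y)"
    by (rule Fubini_bounded_kernel[OF a_int b_int e_meas, of 1]) (simp add: e_norm)
  also have "\<dots> = (LINT y|lborel. \<tau> y * of_real (exp (- (\<sigma> * y)) * k (y - x)))"
  proof (intro Bochner_Integration.integral_cong refl)
    fix y
    have "a t * b y * e t y = b y * (exp (- \<i> * complex_of_real ((y - x) * t)) * \<phi> t)" for t
    proof -
      have "exp (\<i> * of_real x * of_real t) * e t y = exp (- \<i> * complex_of_real ((y - x) * t))"
        unfolding e_def by (subst exp_add[symmetric]) (simp add: algebra_simps)
      moreover have "a t * b y * e t y = b y * ((exp (\<i> * of_real x * of_real t) * e t y) * \<phi> t)"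
        unfolding a_def by (simp only: mult_ac)
      ultimately show ?thesis by (simp only:)
    qed
    then have "(LINT t|lborel. a t * b y * e t y) = b y * fourier \<phi> (y - x)"
      unfolding fourier_def by (simp only: integral_mult_right_zero)
    then show "(LINT t|lborel. a t * b y * e t y) = \<tau> y * of_real (exp (- (\<sigma> * y)) * k (y - x))"
      unfolding \<phi>(2) b_def by simp
  qed
  finally show ?thesis unfolding a_def .
qed

lemma fourier_modulation:
  "fourier (\<lambda>t. exp (- \<i> * of_real x * of_real t) * \<phi> t) y = fourier \<phi> (y + x)"
proof -
  have "exp (- \<i> * complex_of_real (y * t)) * (exp (- \<i> * of_real x * of_real t) * \<phi> t) =
      exp (- \<i> * complex_of_real ((y + x) * t)) * \<phi> t" for t
  proof -
    have "exp (- \<i> * complex_of_real (y * t)) * exp (- \<i> * of_real x * of_real t) = exp (- \<i> * complex_of_real ((y + x) * t))"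
      by (subst exp_add[symmetric]) (simp add: algebra_simps)
    then show ?thesis by (simp only: mult.assoc[symmetric])
  qed
  then show ?thesis unfolding fourier_def by (simp only:)
qed

lemma fourier_translation:
  "fourier (\<lambda>y. \<psi> (y + x)) t = exp (\<i> * of_real x * of_real t) * fourier \<psi> t"
proof -
  have "fourier (\<lambda>y. \<psi> (y + x)) t = (LINT y|lborel. exp (- \<i> * complex_of_real (t * (y - x))) * \<psi> (y - x + x))"
    unfolding fourier_def by (rule lborel_integral_shift[symmetric])
  also have "\<dots> = (LINT y|lborel. exp (\<i> * of_real x * of_real t) * (exp (- \<i> * complex_of_real (t * y)) * \<psi> y))"
  proof (intro Bochner_Integration.integral_cong refl)
    fix y
    have "exp (- \<i> * complex_of_real (t * (y - x))) = exp (\<i> * of_real x * of_real t) * exp (- \<i> * complex_of_real (t * y))"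
      by (subst exp_add[symmetric]) (simp add: algebra_simps)
    then show "exp (- \<i> * complex_of_real (t * (y - x))) * \<psi> (y - x + x) =
        exp (\<i> * of_real x * of_real t) * (exp (- \<i> * complex_of_real (t * y)) * \<psi> y)"
      by (simp add: mult.assoc)
  qed
  also have "\<dots> = exp (\<i> * of_real x * of_real t) * fourier \<psi> t"
    unfolding fourier_def by (rule integral_mult_right_zero)
  finally show ?thesis .
qed

text \<open>The pseudomeasure is accessible through its values on transforms of Schwartz functions,
  so the modulated test function has to be written as such a transform. The translate k(y + x) does
  this up to the factor 2 pi; it is Schwartz because it is itself the transform of a modulation of
  \<phi>. A translate has the same integral as k, whence uniformity in x.\<close>

lemma bounded_averages:
  assumes neg: "\<And>x. x < 0 \<Longrightarrow> \<tau> x = 0"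
    and int: "\<And>\<sigma>. \<sigma> > 0 \<Longrightarrow> integrable lborel (\<lambda>y. \<tau> y * of_real (exp (- (\<sigma> * y))))"
    and bb: "pm_boundary_behavior (laplace \<tau>) 0"
  shows "\<exists>k K T M. (\<forall>u. 0 \<le> k u) \<and> 0 < k 0 \<and> continuous_on UNIV k \<and> integrable lborel (\<lambda>u. (1 + \<bar>u\<bar>) * k u) \<and>
    (\<forall>u. k u \<le> K) \<and>
    (\<forall>x. ((\<lambda>\<sigma>. LINT y|lborel. \<tau> y * of_real (exp (- (\<sigma> * y)) * k (y - x))) \<longlongrightarrow> T x) (at_right 0)) \<and>
    (\<forall>x::real. norm (T x :: complex) \<le> M)"
proof -
  obtain a b g where ab: "a < 0" "0 < b"
    and lim: "\<And>\<phi>. test_fun {a<..<b} \<phi> \<Longrightarrow> ((\<lambda>\<sigma>. LINT t|lborel. laplace \<tau> (Complex \<sigma> t) * \<phi> t) \<longlongrightarrow> g \<phi>) (at_right 0)"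
    and pm: "local_pseudomeasure {a<..<b} g 0"
  proof -
    from bb obtain a b g where ab: "a < 0" "0 < b"
      and *: "\<forall>\<phi>. test_fun {a<..<b} \<phi> \<longrightarrow> ((\<lambda>\<sigma>. LINT t|lborel. laplace \<tau> (Complex \<sigma> t) * \<phi> t) \<longlongrightarrow> g \<phi>) (at_right 0)"
        "\<forall>t\<in>{a<..<b}. local_pseudomeasure {a<..<b} g t"
      unfolding pm_boundary_behavior_def by blast
    show thesis
    proof (rule that[OF ab])
      show "((\<lambda>\<sigma>. LINT t|lborel. laplace \<tau> (Complex \<sigma> t) * \<phi> t) \<longlongrightarrow> g \<phi>) (at_right 0)"
        if "test_fun {a<..<b} \<phi>" for \<phi> using * that by blast
      show "local_pseudomeasure {a<..<b} g 0" using *(2) ab by simp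
    qed
  qed
  then obtain V f where V: "open V" "0 \<in> V" "V \<subseteq> {a<..<b}" and f: "pseudomeasure f"
    and gf: "\<And>\<phi>. test_fun V \<phi> \<Longrightarrow> g \<phi> = f \<phi>"
    unfolding local_pseudomeasure_def by blast
  obtain h Mh where h: "h \<in> borel_measurable lborel" "AE x in lborel. norm (h x :: complex) \<le> Mh"
    and fh: "\<And>\<psi>. schwartz \<psi> \<Longrightarrow> f (fourier \<psi>) = (LINT x|lborel. h x * \<psi> x)"
    using f unfolding pseudomeasure_def fourier_distr_def by blast
  \<comment> \<open>Inside V two things hold at once: g agrees with f, and the boundary limit
    exists. Every modulation of \<phi> keeps its support there.\<close>
  obtain l where l: "l > 0" "cball 0 l \<subseteq> V" using V open_contains_cball by blast
  then have lV: "{- l..l} \<subseteq> V" by (auto simp: dist_real_def subset_iff abs_le_iff)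
  obtain \<phi> k where \<phi>: "csmooth l \<phi>" "\<And>u. fourier \<phi> u = complex_of_real (k u)"
    and k: "\<And>u. k u \<ge> 0" "k 0 > 0" "continuous_on UNIV k" "integrable lborel (\<lambda>u. (1 + \<bar>u\<bar>) * k u)"
    and inv: "\<And>t. fourier (fourier \<phi>) t = of_real (2 * pi) * \<phi> t"
    using kernel_exists[OF l(1)] by blast
  have k_meas: "k \<in> borel_measurable borel" using k(3) by (rule borel_measurable_continuous_onI)
  have k_int: "integrable lborel k" by (rule integrable_kernel_moments(1)[OF k(1) k_meas k(4)])
  define G where "G = (\<lambda>x t. exp (\<i> * of_real x * of_real t) * \<phi> t)"
  define \<psi> where "\<psi> = (\<lambda>x. fourier (\<lambda>t. exp (- \<i> * of_real x * of_real t) * \<phi> t))"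
  have \<psi>_eq: "\<psi> x = (\<lambda>y. complex_of_real (k (y + x)))" for x
    unfolding \<psi>_def by (rule ext) (simp only: fourier_modulation \<phi>(2))
  have \<psi>_schwartz: "schwartz (\<psi> x)" for x
    unfolding \<psi>_def using l(1) by (intro schwartz_fourier[OF csmooth_mult[OF smooth_exp \<phi>(1)]]) simp
  have \<psi>_fourier: "fourier (\<psi> x) = (\<lambda>t. of_real (2 * pi) * G x t)" for x
  proof
    fix t
    have "\<psi> x = (\<lambda>y. fourier \<phi> (y + x))" unfolding \<psi>_eq \<phi>(2) ..
    then have "fourier (\<psi> x) t = exp (\<i> * of_real x * of_real t) * (of_real (2 * pi) * \<phi> t)"
      by (simp only: fourier_translation inv)
    then show "fourier (\<psi> x) t = of_real (2 * pi) * G x t" by (simp add: G_def)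
  qed
  have G_csmooth: "csmooth l (\<lambda>t. of_real (2 * pi) * G x t)" for x
  proof -
    have "csmooth l (\<lambda>t. (of_real (2 * pi) + 0 * of_real t) * (exp ((\<i> * of_real x) * of_real t) * \<phi> t))"
      by (intro csmooth_mult smooth_exp smooth_affine \<phi>)
    then show ?thesis by (simp add: G_def)
  qed
  \<comment> \<open>The transform of \<open>\<psi> x\<close> is 2 pi times the modulated \<phi>; the
    division restores the normalisation.\<close>
  define T where "T = (\<lambda>x. g (fourier (\<psi> x)) / of_real (2 * pi))"
  have "((\<lambda>\<sigma>. LINT y|lborel. \<tau> y * of_real (exp (- (\<sigma> * y)) * k (y - x))) \<longlongrightarrow> T x) (at_right 0)" for x
  proof -
    have "test_fun {a<..<b} (\<lambda>t. of_real (2 * pi) * G x t)"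
      using lV V by (intro csmooth_imp_test_fun[OF G_csmooth]) auto
    from lim[OF this]
    have "((\<lambda>\<sigma>. (LINT t|lborel. laplace \<tau> (Complex \<sigma> t) * (of_real (2 * pi) * G x t)) / of_real (2 * pi)) \<longlongrightarrow> T x) (at_right 0)"
      unfolding T_def \<psi>_fourier by (intro tendsto_divide tendsto_const) auto
    moreover have "\<forall>\<^sub>F \<sigma> in at_right 0. (LINT t|lborel. laplace \<tau> (Complex \<sigma> t) * (of_real (2 * pi) * G x t)) / of_real (2 * pi) =
       (LINT y|lborel. \<tau> y * of_real (exp (- (\<sigma> * y)) * k (y - x)))"
      using eventually_at_right_less[of "0::real"]
    proof eventually_elim
      case (elim \<sigma>)
      have "(LINT t|lborel. laplace \<tau> (Complex \<sigma> t) * (of_real (2 * pi) * G x t)) =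
          (LINT t|lborel. of_real (2 * pi) * (laplace \<tau> (Complex \<sigma> t) * G x t))"
        by (simp only: mult.left_commute)
      also have "\<dots> = of_real (2 * pi) * (LINT t|lborel. laplace \<tau> (Complex \<sigma> t) * G x t)"
        by (rule integral_mult_right_zero)
      also have "(LINT t|lborel. laplace \<tau> (Complex \<sigma> t) * G x t) = (LINT y|lborel. \<tau> y * of_real (exp (- (\<sigma> * y)) * k (y - x)))"
        unfolding G_def by (rule pairing_eq_average[OF neg int[OF elim] \<phi>])
      finally show ?case by simp
    qed
    ultimately show ?thesis by (rule Lim_transform_eventually)
  qed
  moreover have "norm (T x) \<le> \<bar>Mh\<bar> * (LINT u|lborel. k u) / (2 * pi)" for x
  proof -
    have "test_fun V (fourier (\<psi> x))" unfolding \<psi>_fourier by (rule csmooth_imp_test_fun[OF G_csmooth lV])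
    then have "g (fourier (\<psi> x)) = (LINT y|lborel. h y * \<psi> x y)"
      using gf fh[OF \<psi>_schwartz] by simp
    also have "norm \<dots> \<le> (LINT y|lborel. \<bar>Mh\<bar> * k (y + x))"
    proof -
      have i: "integrable lborel (\<lambda>y. k (y + x))" using lborel_integrable_shift[OF k_int, of "- x"] by simp
      then have 1: "integrable lborel (\<lambda>y. \<bar>Mh\<bar> * k (y + x))" by simp
      have le: "AE y in lborel. norm (h y * \<psi> x y) \<le> \<bar>Mh\<bar> * k (y + x)"
        using h(2)
      proof eventually_elim
        case (elim y)
        then have "norm (h y) * k (y + x) \<le> \<bar>Mh\<bar> * k (y + x)" using k(1) by (intro mult_right_mono) auto
        then show ?case using k(1)[of "y + x"] by (simp add: \<psi>_eq norm_mult)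
      qed
      have 2: "integrable lborel (\<lambda>y. h y * \<psi> x y)"
      proof (rule Bochner_Integration.integrable_bound[OF 1])
        show "(\<lambda>y. h y * \<psi> x y) \<in> borel_measurable lborel"
          unfolding \<psi>_eq using h(1) k_meas by measurable
        show "AE y in lborel. norm (h y * \<psi> x y) \<le> norm (\<bar>Mh\<bar> * k (y + x))"
          using le by eventually_elim (rule order_trans, assumption, simp)
      qed
      show ?thesis
        by (rule order_trans[OF integral_norm_bound integral_mono_AE[OF integrable_norm[OF 2] 1 le]])
    qed
    also have "\<dots> = \<bar>Mh\<bar> * (LINT u|lborel. k u)"
      using lborel_integral_shift[of k "- x"] by simp
    finally show ?thesis by (simp add: T_def norm_divide divide_right_mono)
  qed
  moreover have "k u \<le> (LINT t|lborel. norm (\<phi> t))" for u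
    using fourier_bounded[of \<phi> u] k(1)[of u] unfolding \<phi>(2) by simp
  ultimately show ?thesis using k by (intro exI[of _ k] exI[of _ T]) blast
qed

section \<open>Real and imaginary parts, and the two Tauberian conditions\<close>

lemma absolutely_convergent_components:
  fixes \<tau> :: "real \<Rightarrow> complex"
  assumes re: "integrable lborel (\<lambda>y. Re (\<tau> y) * exp (- (\<sigma> * y)))"
    and im: "integrable lborel (\<lambda>y. Im (\<tau> y) * exp (- (\<sigma> * y)))"
  shows "integrable lborel (\<lambda>y. \<tau> y * of_real (exp (- (\<sigma> * y))))"
proof -
  have "integrable lborel (\<lambda>y. complex_of_real (Re (\<tau> y) * exp (- (\<sigma> * y))) + \<i> * complex_of_real (Im (\<tau> y) * exp (- (\<sigma> * y))))"
    using re im by (intro Bochner_Integration.integrable_add integrable_mult_right integrable_of_real)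
  moreover have "complex_of_real (Re (\<tau> y) * exp (- (\<sigma> * y))) + \<i> * complex_of_real (Im (\<tau> y) * exp (- (\<sigma> * y))) = \<tau> y * of_real (exp (- (\<sigma> * y)))" for y
    by (simp add: complex_eq_iff)
  ultimately show ?thesis by (simp only:)
qed

lemma set_integrable_Re_Im:
  fixes \<tau> :: "real \<Rightarrow> complex"
  assumes "set_integrable lborel A \<tau>"
  shows "set_integrable lborel A (\<lambda>y. Re (\<tau> y))" "set_integrable lborel A (\<lambda>y. Im (\<tau> y))"
  using integrable_Re[OF assms[unfolded set_integrable_def]] integrable_Im[OF assms[unfolded set_integrable_def]]
  by (simp_all add: set_integrable_def)

text \<open>At a real point s the exponential factor is real, so real and imaginary parts pass to
  \<tau> inside the partial integrals.\<close>

lemma laplace_converges_components: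
  fixes \<tau> :: "real \<Rightarrow> complex"
  assumes loc: "\<And>a b. set_integrable lborel {a..b} \<tau>"
    and "laplace_converges \<tau> (of_real s)"
  shows "\<exists>L. ((\<lambda>T. LINT y:{0..T}|lborel. Re (\<tau> y) * exp (- (s * y))) \<longlongrightarrow> L) at_top"
    and "\<exists>L. ((\<lambda>T. LINT y:{0..T}|lborel. Im (\<tau> y) * exp (- (s * y))) \<longlongrightarrow> L) at_top"
proof -
  obtain L where L: "(laplace_partial \<tau> (of_real s) \<longlongrightarrow> L) at_top"
    using assms(2) unfolding laplace_converges_def by blast
  let ?f = "\<lambda>y. \<tau> y * of_real (exp (- (s * y)))"
  have f: "laplace_partial \<tau> (of_real s) T = (LINT y|lborel. indicator {0..T} y *\<^sub>R ?f y)" for T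
    unfolding laplace_partial_def set_lebesgue_integral_def by (simp flip: exp_of_real)
  have int: "integrable lborel (\<lambda>y. indicator {0..T} y *\<^sub>R ?f y)" for T
  proof -
    have "integrable lborel (\<lambda>y. (indicator {0..T} y *\<^sub>R \<tau> y) * of_real (exp (- (s * y))))"
    proof (rule absolutely_convergent_components)
      show "integrable lborel (\<lambda>y. Re (indicator {0..T} y *\<^sub>R \<tau> y) * exp (- (s * y)))"
        using set_integrable_mult_exp[OF set_integrable_Re_Im(1)[OF loc], of 0 T s]
        by (simp add: set_integrable_def mult.assoc)
      show "integrable lborel (\<lambda>y. Im (indicator {0..T} y *\<^sub>R \<tau> y) * exp (- (s * y)))"
        using set_integrable_mult_exp[OF set_integrable_Re_Im(2)[OF loc], of 0 T s]
        by (simp add: set_integrable_def mult.assoc)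
    qed
    then show ?thesis by (simp only: mult_scaleR_left)
  qed
  have "Re (laplace_partial \<tau> (of_real s) T) = (LINT y:{0..T}|lborel. Re (\<tau> y) * exp (- (s * y)))"
    "Im (laplace_partial \<tau> (of_real s) T) = (LINT y:{0..T}|lborel. Im (\<tau> y) * exp (- (s * y)))" for T
    unfolding f set_lebesgue_integral_def
    using integral_Re[OF int[of T]] integral_Im[OF int[of T]] by simp_all
  with tendsto_Re[OF L] tendsto_Im[OF L]
  show "\<exists>L. ((\<lambda>T. LINT y:{0..T}|lborel. Re (\<tau> y) * exp (- (s * y))) \<longlongrightarrow> L) at_top"
    and "\<exists>L. ((\<lambda>T. LINT y:{0..T}|lborel. Im (\<tau> y) * exp (- (s * y))) \<longlongrightarrow> L) at_top"
    by auto
qed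

lemma bdd_decreasing_exp_integrable:
  fixes \<rho> :: "real \<Rightarrow> real"
  assumes loc: "\<And>a b. set_integrable lborel {a..b} \<rho>" and neg: "\<And>y. y < 0 \<Longrightarrow> \<rho> y = 0"
    and conv: "\<And>s. s > 0 \<Longrightarrow> \<exists>L. ((\<lambda>T. LINT y:{0..T}|lborel. \<rho> y * exp (- (s * y))) \<longlongrightarrow> L) at_top"
    and bd: "bdd_decreasing_real \<rho>" and \<sigma>: "\<sigma> > 0"
  shows "integrable lborel (\<lambda>y. \<rho> y * exp (- (\<sigma> * y)))"
proof -
  obtain \<delta> X C where pos: "\<delta> > 0" "X \<ge> 0" "C \<ge> 0"
    and step: "\<And>x h. X \<le> x \<Longrightarrow> 0 \<le> h \<Longrightarrow> h \<le> \<delta> \<Longrightarrow> \<rho> (x + h) \<ge> \<rho> x - C"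
    using bdd_decreasing_realE[OF bd] by blast
  \<comment> \<open>Dictated by \<rho>(y) \<ge> \<rho>(X) - C(1 + (y - X)/\<delta>), the iterated
    decrease condition started at X.\<close>
  define D where "D = \<bar>\<rho> X\<bar> + C + C / \<delta>"
  have low: "\<rho> y \<ge> - (D * (1 + y))" if "X \<le> y" for y
  proof -
    have y: "0 \<le> y" using that pos by simp
    have "\<rho> (X + (y - X)) \<ge> \<rho> X - C * (1 + (y - X) / \<delta>)"
      using that by (intro additive_decrease[OF step pos(1,3)]) auto
    moreover have "C * ((y - X) / \<delta>) \<le> C / \<delta> * y" using pos that by (simp add: field_simps)
    moreover have "0 \<le> \<bar>\<rho> X\<bar> * y" "0 \<le> C * y" "0 \<le> C / \<delta>" using pos y by simp_all
    moreover have "D * (1 + y) = \<bar>\<rho> X\<bar> + C + C / \<delta> + \<bar>\<rho> X\<bar> * y + C * y + C / \<delta> * y"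
      by (simp add: D_def algebra_simps add_divide_distrib)
    moreover have "C * (1 + (y - X) / \<delta>) = C + C * ((y - X) / \<delta>)" by (simp only: distrib_left mult_1_right)
    ultimately show ?thesis by simp
  qed
  have "1 * \<rho> x - C \<le> \<rho> (x + h)" if "X \<le> x" "0 \<le> h" "h \<le> \<delta>" for x h using step[OF that] by simp
  moreover have "0 \<le> D" using pos by (simp add: D_def)
  ultimately show ?thesis
    using absolutely_convergent_laplace[OF loc neg conv _ low pos(2,1) _ pos(3) _ \<sigma>, of 1] by simp
qed

text \<open>The kernel is real, and its boundedness keeps the integrand integrable for each \<sigma>
  > 0; these are the only \<sigma> that a limit from the right sees.\<close>

lemma average_Re_Im:
  fixes \<tau> :: "real \<Rightarrow> complex"
  assumes int: "\<And>\<sigma>. \<sigma> > 0 \<Longrightarrow> integrable lborel (\<lambda>y. \<tau> y * of_real (exp (- (\<sigma> * y))))"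
    and k: "k \<in> borel_measurable borel" "\<And>u. \<bar>k u\<bar> \<le> B"
    and lim: "((\<lambda>\<sigma>. LINT y|lborel. \<tau> y * of_real (exp (- (\<sigma> * y)) * k (y - x))) \<longlongrightarrow> T) (at_right 0)"
  shows "((\<lambda>\<sigma>. LINT y|lborel. Re (\<tau> y) * exp (- (\<sigma> * y)) * k (y - x)) \<longlongrightarrow> Re T) (at_right 0)"
    and "((\<lambda>\<sigma>. LINT y|lborel. Im (\<tau> y) * exp (- (\<sigma> * y)) * k (y - x)) \<longlongrightarrow> Im T) (at_right 0)"
proof -
  have eq: "Re (LINT y|lborel. \<tau> y * of_real (exp (- (\<sigma> * y)) * k (y - x))) = (LINT y|lborel. Re (\<tau> y) * exp (- (\<sigma> * y)) * k (y - x))"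
    "Im (LINT y|lborel. \<tau> y * of_real (exp (- (\<sigma> * y)) * k (y - x))) = (LINT y|lborel. Im (\<tau> y) * exp (- (\<sigma> * y)) * k (y - x))"
    if \<sigma>: "\<sigma> > 0" for \<sigma>
  proof -
    have "integrable lborel (\<lambda>y. (\<tau> y * of_real (exp (- (\<sigma> * y)))) * of_real (k (y - x)))"
    proof (rule Bochner_Integration.integrable_bound)
      show "integrable lborel (\<lambda>y. of_real B * (\<tau> y * of_real (exp (- (\<sigma> * y)))))"
        by (intro integrable_mult_right int \<sigma>)
      show "(\<lambda>y. (\<tau> y * of_real (exp (- (\<sigma> * y)))) * of_real (k (y - x))) \<in> borel_measurable lborel"
        using k(1) borel_measurable_integrable[OF int[OF \<sigma>]] by measurable
      show "AE y in lborel. norm ((\<tau> y * of_real (exp (- (\<sigma> * y)))) * of_real (k (y - x)))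
          \<le> norm (of_real B * (\<tau> y * of_real (exp (- (\<sigma> * y)))))"
      proof (rule AE_I2)
        fix y
        have "\<bar>k (y - x)\<bar> \<le> \<bar>B\<bar>" using k(2)[of "y - x"] by linarith
        then have "norm (\<tau> y * of_real (exp (- (\<sigma> * y)))) * \<bar>k (y - x)\<bar> \<le> norm (\<tau> y * of_real (exp (- (\<sigma> * y)))) * \<bar>B\<bar>"
          by (rule mult_left_mono) simp
        then show "norm ((\<tau> y * of_real (exp (- (\<sigma> * y)))) * of_real (k (y - x)))
          \<le> norm (of_real B * (\<tau> y * of_real (exp (- (\<sigma> * y)))))"
          by (simp only: norm_mult norm_of_real mult.commute)
      qed
    qed
    then have i: "integrable lborel (\<lambda>y. \<tau> y * of_real (exp (- (\<sigma> * y)) * k (y - x)))"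
      by (simp only: mult.assoc of_real_mult)
    show "Re (LINT y|lborel. \<tau> y * of_real (exp (- (\<sigma> * y)) * k (y - x))) = (LINT y|lborel. Re (\<tau> y) * exp (- (\<sigma> * y)) * k (y - x))"
      "Im (LINT y|lborel. \<tau> y * of_real (exp (- (\<sigma> * y)) * k (y - x))) = (LINT y|lborel. Im (\<tau> y) * exp (- (\<sigma> * y)) * k (y - x))"
      unfolding integral_Re[OF i, symmetric] integral_Im[OF i, symmetric]
      by (intro Bochner_Integration.integral_cong refl; simp add: mult.assoc flip: of_real_mult)+
  qed
  show "((\<lambda>\<sigma>. LINT y|lborel. Re (\<tau> y) * exp (- (\<sigma> * y)) * k (y - x)) \<longlongrightarrow> Re T) (at_right 0)"
    by (rule Lim_transform_eventually[OF tendsto_Re[OF lim] eventually_mono[OF eventually_at_right_less eq(1)]])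
  show "((\<lambda>\<sigma>. LINT y|lborel. Im (\<tau> y) * exp (- (\<sigma> * y)) * k (y - x)) \<longlongrightarrow> Im T) (at_right 0)"
    by (rule Lim_transform_eventually[OF tendsto_Im[OF lim] eventually_mono[OF eventually_at_right_less eq(2)]])
qed

theorem theorem3p1:
  fixes \<tau> :: "real \<Rightarrow> complex"
  assumes loc_int: "\<And>a b. set_integrable lborel {a..b} \<tau>"
    and vanish: "\<And>x. x < 0 \<Longrightarrow> \<tau> x = 0"
    and conv: "\<And>s. Re s > 0 \<Longrightarrow> laplace_converges \<tau> s"
    and T: "bdd_decreasing \<tau> \<or>
            (\<exists>x0 \<beta>. x0 \<ge> 0 \<and>
               (\<forall>x\<ge>x0. exp (complex_of_real (\<beta> * x)) * \<tau> x \<in> \<real> \<and>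
                        0 \<le> Re (exp (complex_of_real (\<beta> * x)) * \<tau> x)) \<and>
               (\<forall>x y. x0 \<le> x \<longrightarrow> x \<le> y \<longrightarrow>
                  Re (exp (complex_of_real (\<beta> * x)) * \<tau> x)
                    \<le> Re (exp (complex_of_real (\<beta> * y)) * \<tau> y)))"
    and bb: "pm_boundary_behavior (laplace \<tau>) 0"
  shows "\<exists>M. \<forall>\<^sub>F x in at_top. norm (\<tau> x) \<le> M"
proof -
  let ?R = "\<lambda>y. Re (\<tau> y)" and ?I = "\<lambda>y. Im (\<tau> y)"
  have loc: "set_integrable lborel {a..b} ?R" "set_integrable lborel {a..b} ?I" for a b
    using set_integrable_Re_Im[OF loc_int] by blast+
  have neg: "?R y = 0" "?I y = 0" if "y < 0" for y using vanish[OF that] by simp_all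
  have cv: "\<exists>L. ((\<lambda>T. LINT y:{0..T}|lborel. ?R y * exp (- (s * y))) \<longlongrightarrow> L) at_top"
    "\<exists>L. ((\<lambda>T. LINT y:{0..T}|lborel. ?I y * exp (- (s * y))) \<longlongrightarrow> L) at_top" if "s > 0" for s
    using laplace_converges_components[OF loc_int conv[of "of_real s"]] that by auto
  from T show ?thesis
  proof
    assume "bdd_decreasing \<tau>"
    then have bd: "bdd_decreasing_real ?R" "bdd_decreasing_real ?I" by (auto simp: bdd_decreasing_def)
    have ei: "integrable lborel (\<lambda>y. ?R y * exp (- (\<sigma> * y)))" "integrable lborel (\<lambda>y. ?I y * exp (- (\<sigma> * y)))" if "\<sigma> > 0" for \<sigma>
      using bdd_decreasing_exp_integrable[OF loc(1) neg(1) cv(1) bd(1) that]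
        bdd_decreasing_exp_integrable[OF loc(2) neg(2) cv(2) bd(2) that] by blast+
    have int: "integrable lborel (\<lambda>y. \<tau> y * of_real (exp (- (\<sigma> * y))))" if "\<sigma> > 0" for \<sigma>
      using absolutely_convergent_components[OF ei[OF that]] .
    obtain k K L M where *: "\<forall>u. 0 \<le> k u" "0 < k 0" "continuous_on UNIV k" "integrable lborel (\<lambda>u. (1 + \<bar>u\<bar>) * k u)"
      "\<forall>u. k u \<le> K"
      "\<forall>x. ((\<lambda>\<sigma>. LINT y|lborel. \<tau> y * of_real (exp (- (\<sigma> * y)) * k (y - x))) \<longlongrightarrow> L x) (at_right 0)"
      "\<forall>x. norm (L x) \<le> M"
      using bounded_averages[OF vanish int bb] by blast
    note k = *(1-5)[rule_format] and lim = *(6)[rule_format] and M = *(7)[rule_format]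
    have k_meas: "k \<in> borel_measurable borel" using k(3) by (rule borel_measurable_continuous_onI)
    have k_abs: "\<bar>k u\<bar> \<le> K" for u using k by simp
    \<comment> \<open>Formulated for an arbitrary real function so that it serves both parts of
      \<tau>, with limits \<open>Re (L x)\<close> and \<open>Im (L x)\<close> and the common bound
      M.\<close>
    have "\<exists>B X. \<forall>x\<ge>X. \<bar>\<rho> x\<bar> \<le> B"
      if hyp: "\<And>a b. set_integrable lborel {a..b} \<rho>" "\<And>y. y < 0 \<Longrightarrow> \<rho> y = 0"
        "\<And>\<sigma>. \<sigma> > 0 \<Longrightarrow> integrable lborel (\<lambda>y. \<rho> y * exp (- (\<sigma> * y)))"
        "\<And>x. ((\<lambda>\<sigma>. LINT y|lborel. \<rho> y * exp (- (\<sigma> * y)) * k (y - x)) \<longlongrightarrow> S x) (at_right 0)"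
        "\<And>x. \<bar>S x\<bar> \<le> M" "bdd_decreasing_real \<rho>" for \<rho> S :: "real \<Rightarrow> real"
    proof -
      obtain \<delta> X C where pos: "\<delta> > 0" "X \<ge> 0" "C \<ge> 0"
        and step: "\<And>x h. X \<le> x \<Longrightarrow> 0 \<le> h \<Longrightarrow> h \<le> \<delta> \<Longrightarrow> \<rho> (x + h) \<ge> \<rho> x - C"
        using bdd_decreasing_realE[OF hyp(6)] by blast
      show ?thesis
        using bounded_if_decrease_controlled[OF hyp(1-3) k(1) k_meas k(4,5) kernel_mass_pos[OF k(3,1,2) pos(1)] hyp(4,5) step pos(2,1,3)]
        by blast
    qed
    note bound = this
    have "\<bar>Re (L x)\<bar> \<le> M" "\<bar>Im (L x)\<bar> \<le> M" for x
      using abs_Re_le_cmod[of "L x"] abs_Im_le_cmod[of "L x"] M[of x] by linarith+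
    note LM = this
    obtain B1 X1 where 1: "\<And>x. x \<ge> X1 \<Longrightarrow> \<bar>?R x\<bar> \<le> B1"
      using bound[OF loc(1) neg(1) ei(1) average_Re_Im(1)[OF int k_meas k_abs lim] LM(1) bd(1)] by blast
    obtain B2 X2 where 2: "\<And>x. x \<ge> X2 \<Longrightarrow> \<bar>?I x\<bar> \<le> B2"
      using bound[OF loc(2) neg(2) ei(2) average_Re_Im(2)[OF int k_meas k_abs lim] LM(2) bd(2)] by blast
    have "norm (\<tau> x) \<le> B1 + B2" if "x \<ge> max X1 X2" for x
      using 1[of x] 2[of x] cmod_le[of "\<tau> x"] that by linarith
    then show ?thesis unfolding eventually_at_top_linorder by blast
  next
    assume "\<exists>x0 \<beta>. x0 \<ge> 0 \<and>
               (\<forall>x\<ge>x0. exp (complex_of_real (\<beta> * x)) * \<tau> x \<in> \<real> \<and>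
                        0 \<le> Re (exp (complex_of_real (\<beta> * x)) * \<tau> x)) \<and>
               (\<forall>x y. x0 \<le> x \<longrightarrow> x \<le> y \<longrightarrow>
                  Re (exp (complex_of_real (\<beta> * x)) * \<tau> x)
                    \<le> Re (exp (complex_of_real (\<beta> * y)) * \<tau> y))"
    then obtain X \<beta> where X: "X \<ge> 0"
      and real: "\<And>x. x \<ge> X \<Longrightarrow> exp (complex_of_real (\<beta> * x)) * \<tau> x \<in> \<real>"
      and nonneg: "\<And>x. x \<ge> X \<Longrightarrow> 0 \<le> Re (exp (complex_of_real (\<beta> * x)) * \<tau> x)"
      and mono: "\<And>x y. X \<le> x \<Longrightarrow> x \<le> y \<Longrightarrow> Re (exp (complex_of_real (\<beta> * x)) * \<tau> x) \<le> Re (exp (complex_of_real (\<beta> * y)) * \<tau> y)"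
      by blast
    have comp: "Re (exp (complex_of_real (\<beta> * x)) * \<tau> x) = exp (\<beta> * x) * ?R x"
      "Im (exp (complex_of_real (\<beta> * x)) * \<tau> x) = exp (\<beta> * x) * ?I x" for x
      unfolding exp_of_real by simp_all
    have I0: "?I x = 0" if "x \<ge> X" for x
    proof -
      have "exp (\<beta> * x) * ?I x = 0" using real[OF that] unfolding comp(2)[symmetric] complex_is_Real_iff .
      then show ?thesis by simp
    qed
    have R0: "0 \<le> ?R x" if "x \<ge> X" for x
      using nonneg[OF that] unfolding comp by (simp add: zero_le_mult_iff)
    \<comment> \<open>Monotonicity gives R(x + h) \<ge> e^{-\<beta>h} R(x). For R \<ge> 0 and 0
      \<le> h \<le> 1 the factor is at least e^{-|\<beta>|}, whatever the sign of \<beta>; hence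
      \<delta> = 1 and C = 0.\<close>
    define c where "c = exp (- \<bar>\<beta>\<bar>)"
    have growth: "?R (x + h) \<ge> c * ?R x - 0" if "X \<le> x" "0 \<le> h" "h \<le> 1" for x h
    proof -
      have "exp (\<beta> * x) * ?R x \<le> exp (\<beta> * (x + h)) * ?R (x + h)"
        using mono[of x "x + h"] that unfolding comp by simp
      also have "\<dots> = exp (\<beta> * x) * (exp (\<beta> * h) * ?R (x + h))" by (simp add: distrib_left exp_add)
      finally have 1: "?R x \<le> exp (\<beta> * h) * ?R (x + h)" by simp
      have "\<beta> * h \<le> \<bar>\<beta>\<bar> * h" using that by (intro mult_right_mono) auto
      also have "\<dots> \<le> \<bar>\<beta>\<bar>" using that by (simp add: mult_left_le)
      finally have "exp (\<beta> * h) * ?R (x + h) \<le> exp \<bar>\<beta>\<bar> * ?R (x + h)" using R0[of "x + h"] that by (intro mult_right_mono) auto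
      with 1 have "c * ?R x \<le> c * (exp \<bar>\<beta>\<bar> * ?R (x + h))" by (intro mult_left_mono) (auto simp: c_def)
      also have "\<dots> = ?R (x + h)" by (simp add: c_def mult.assoc[symmetric] exp_add[symmetric])
      finally show ?thesis by simp
    qed
    have c: "0 < c" by (simp add: c_def)
    have low: "?R y \<ge> - (0 * (1 + y))" if "X \<le> y" for y using R0[OF that] by simp
    have ei: "integrable lborel (\<lambda>y. ?R y * exp (- (\<sigma> * y)))" if "\<sigma> > 0" for \<sigma>
      using absolutely_convergent_laplace[OF loc(1) neg(1) cv(1) growth low X _ c _ _ that] by simp
    \<comment> \<open>The imaginary part vanishes outside [0, X), so local integrability gives this
      for every real \<sigma>.\<close>
    have "integrable lborel (\<lambda>y. ?I y * exp (- (\<sigma> * y)))" for \<sigma>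
    proof -
      have "indicator {0..X} y *\<^sub>R (?I y * exp (- (\<sigma> * y))) = ?I y * exp (- (\<sigma> * y))" for y
        using neg(2)[of y] I0[of y] by (cases "y < 0"; cases "X \<le> y") (auto simp: indicator_def)
      then show ?thesis
        using set_integrable_mult_exp[OF loc(2), of 0 X \<sigma>] unfolding set_integrable_def by (simp only:)
    qed
    note int = absolutely_convergent_components[OF ei this]
    obtain k K L M where *: "\<forall>u. 0 \<le> k u" "0 < k 0" "continuous_on UNIV k" "integrable lborel (\<lambda>u. (1 + \<bar>u\<bar>) * k u)"
      "\<forall>u. k u \<le> K"
      "\<forall>x. ((\<lambda>\<sigma>. LINT y|lborel. \<tau> y * of_real (exp (- (\<sigma> * y)) * k (y - x))) \<longlongrightarrow> L x) (at_right 0)"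
      "\<forall>x. norm (L x) \<le> M"
      using bounded_averages[OF vanish int bb] by blast
    note k = *(1-5)[rule_format] and lim = *(6)[rule_format] and M = *(7)[rule_format]
    have k_meas: "k \<in> borel_measurable borel" using k(3) by (rule borel_measurable_continuous_onI)
    have k_abs: "\<bar>k u\<bar> \<le> K" for u using k by simp
    have LM: "Re (L x) \<le> M" for x using complex_Re_le_cmod[of "L x"] M[of x] by linarith
    \<comment> \<open>Non-negativity allows D = 0, so the bound is the constant E and this case
      closes without absorption.\<close>
    have "\<exists>E\<ge>0. \<forall>x\<ge>X. ?R x \<le> E * (1 + 0 * (1 + x))"
      by (rule linear_growth[OF loc(1) neg(1) ei k(1) k_meas k(4,5) kernel_mass_pos[OF k(3,1,2), of 1]
            average_Re_Im(1)[OF int k_meas k_abs lim] LM growth low X c]) simp_all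
    then obtain E where E: "\<And>x. x \<ge> X \<Longrightarrow> ?R x \<le> E" by auto
    have "norm (\<tau> x) \<le> E" if "x \<ge> X" for x
      using cmod_le[of "\<tau> x"] E[OF that] R0[OF that] I0[OF that] by simp
    then show ?thesis unfolding eventually_at_top_linorder by blast
  qed
qed

end
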